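(* Let $\Theta^*\in\mathbb{R}^{k\times p}$ have rank $r\ge1$, let $N>40^2\,r\,(k+p)$, and let $X_1,\dots,X_N\in\mathbb{R}^{k\times p}$ be independent random matrices, each with i.i.d. $N(0,1)$ entries. Suppose we observe the noiseless samples $y_i=\operatorname{trace}(X_i^T\Theta^* )$, $i=1,\dots,N$. Then, with probability at least $1-2\exp(-N/32)$, the program $$\min_{\Theta\in\mathbb{R}^{k\times p}}\|\Theta\|_1\quad\text{such that}\quad\operatorname{trace}(X_i^T\Theta)=y_i\ \text{ for all } i=1,\dots,N$$ recovers $\Theta^*$ exactly, i.e. $\Theta^*$ is its unique optimal solution.
   Context: $\|\Theta\|_1$ denotes the nuclear norm of $\Theta$ (sum of its singular values). *)

theory Defs
  imports "HOL-Probability.Probability"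
begin

definition eigenspace :: "real^'n^'n \<Rightarrow> real \<Rightarrow> (real^'n) set" where
  "eigenspace A c = {v. A *v v = c *\<^sub>R v}"

definition singular_values :: "real^'p^'k \<Rightarrow> real set" where
  "singular_values A = {s. 0 \<le> s \<and> (\<exists>v. v \<noteq> 0 \<and> v \<in> eigenspace (transpose A ** A) (s\<^sup>2))}"

text \<open>Each singular value counts with its multiplicity. As the Gram matrix of \<open>A\<close> is
  symmetric, this is the dimension of the corresponding eigenspace. The multiplicity of the
  singular value 0 depends on which of the two Gram matrices is used, but it does not
  contribute to the sum.\<close>

definition nuclear_norm :: "real^'p^'k \<Rightarrow> real" where
  "nuclear_norm A =
     (\<Sum>s\<in>singular_values A. real (dim (eigenspace (transpose A ** A) (s\<^sup>2))) * s)"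

text \<open>The index set of the sum above is finite.\<close>

lemma finite_singular_values: "finite (singular_values (A :: real^'p^'k))"
proof -
  let ?G = "transpose A ** A"
  have "\<forall>s\<in>singular_values A. \<exists>v. v \<noteq> 0 \<and> ?G *v v = s\<^sup>2 *\<^sub>R v"
    unfolding singular_values_def eigenspace_def by blast
  then obtain v where v: "\<And>s. s \<in> singular_values A \<Longrightarrow> v s \<noteq> 0 \<and> ?G *v v s = s\<^sup>2 *\<^sub>R v s"
    by (auto dest!: bchoice)
  have orth: "v s \<bullet> v t = 0"
    if st: "s \<in> singular_values A" "t \<in> singular_values A" "s \<noteq> t" for s t
  proof -
    have sym: "transpose ?G = ?G" by (simp add: matrix_transpose_mul)
    have "(?G *v v s) \<bullet> v t = v s \<bullet> (?G *v v t)"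
      by (metis dot_lmul_matrix sym transpose_matrix_vector)
    then have "(s\<^sup>2 - t\<^sup>2) * (v s \<bullet> v t) = 0"
      using v[OF st(1)] v[OF st(2)] by (simp add: algebra_simps)
    moreover have "s\<^sup>2 \<noteq> t\<^sup>2"
      using st by (auto simp: singular_values_def power2_eq_iff_nonneg)
    ultimately show ?thesis by simp
  qed
  have "inj_on v (singular_values A)"
    using orth v by (metis (no_types) inj_onI inner_eq_zero_iff)
  moreover have "finite (v ` singular_values A)"
  proof (rule pairwise_orthogonal_imp_finite)
    show "pairwise orthogonal (v ` singular_values A)"
      unfolding pairwise_def orthogonal_def using orth by blast
  qed
  ultimately show ?thesis by (rule finite_imageD[rotated])
qed

end

theory Submission
  imports Defs
begin

text \<open>
  Since the samples are noiseless, recovery fails exactly when the kernel of the measurement map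
  contains a descent direction of the nuclear norm, that is, a matrix \<open>\<Delta> \<noteq> 0\<close> with
  \<open>X i \<bullet> \<Delta> = 0\<close> for all \<open>i\<close> and \<open>nuclear_norm (\<Theta>' + \<Delta>) \<le> nuclear_norm \<Theta>'\<close>. The
  infinitely many descent directions are reduced to a finite family of matrices whose
  measurements have to be controlled; a union bound then takes the place of comparison
  inequalities for Gaussian processes.

  By duality with the operator norm, a descent direction \<open>\<Delta>\<close> has nuclear norm at most
  \<open>sqrt (5 * r) * norm \<Delta>\<close>: it is that number times a convex combination of rank-one matrices
  \<open>outer u v\<close> with \<open>u\<close> and \<open>v\<close> in the unit balls (\<open>descent_direction_atomic\<close>). Replacing the
  unit balls by finite nets, whose convex hulls still contain smaller balls, costs a constant
  factor. So, after scaling, every descent direction lies in the convex hull of a set \<open>S\<close> of at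
  most \<open>9 ^ (k + p)\<close> atoms of norm at most 1, and its squared norm is at least \<open>1 / (16 * r)\<close>
  (\<open>finite_atoms\<close>, \<open>descent_direction_in_hull\<close>).

  Suppose that such a matrix \<open>c\<close> in the hull is in the kernel and that the squared measurements
  of each atom sum to at most \<open>2 * N\<close>. Draw \<open>m\<close> atoms independently with mean \<open>c\<close>. The
  measurements of their sum consist of sampling noise only, of expected squared size at most
  \<open>m * (2 * N)\<close>, whereas its expected squared norm is at least \<open>m\<^sup>2 * (norm c)\<^sup>2\<close>. With
  \<open>m = 130 * r\<close>, some sum \<open>z\<close> of \<open>m\<close> atoms satisfies
  \<open>(\<Sum>i. (X i \<bullet> z)\<^sup>2) < N / 4 * (norm z)\<^sup>2\<close> (\<open>kernel_in_hull_gives_short_sum\<close>).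

  For a fixed unit matrix the sum of the squared measurements has the chi-squared distribution
  with \<open>N\<close> degrees of freedom, and both deviations above, up to \<open>2 * N\<close> and down to \<open>N / 4\<close>,
  have exponentially small probability (\<open>gaussian_measurements_tail\<close>). There are at most
  \<open>9 ^ (k + p)\<close> atoms and at most \<open>9 ^ (130 * r * (k + p))\<close> sums, and
  \<open>N > 1600 * r * (k + p)\<close> is large enough for each of the two union bounds to stay below
  \<open>exp (- N / 32)\<close>.

  A lower bound on the measure of the event of recovery also requires that this event is
  measurable (\<open>recovery_failure_measurable\<close>).
\<close>

section \<open>Orthonormal sets and rank-one matrices\<close>

definition orthonormal :: "'a::real_inner set \<Rightarrow> bool" where
  "orthonormal B \<longleftrightarrow> pairwise orthogonal B \<and> (\<forall>v\<in>B. norm v = 1)"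

definition outer :: "real^'k \<Rightarrow> real^'p \<Rightarrow> real^'p^'k" where
  "outer u v = (\<chi> i j. u $ i * v $ j)"

lemma orthonormal_finite: "orthonormal (B :: 'a::euclidean_space set) \<Longrightarrow> finite B"
  by (simp add: orthonormal_def pairwise_orthogonal_imp_finite)

lemma orthonormal_inner:
  "\<lbrakk>orthonormal B; v \<in> B; w \<in> B\<rbrakk> \<Longrightarrow> v \<bullet> w = (if v = w then 1 else 0)"
  by (auto simp: orthonormal_def pairwise_def orthogonal_def norm_eq_1)

lemma orthonormal_expand:
  assumes "orthonormal (B :: 'a::euclidean_space set)" "x \<in> span B"
  shows "(\<Sum>v\<in>B. (x \<bullet> v) *\<^sub>R v) = x"
  using assms orthonormal_basis_expand[of B x] orthonormal_finite[of B]
  by (auto simp: orthonormal_def)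

lemma orthonormal_parseval:
  assumes "orthonormal (B :: 'a::euclidean_space set)" "x \<in> span B"
  shows "x \<bullet> y = (\<Sum>v\<in>B. (x \<bullet> v) * (y \<bullet> v))"
proof -
  have "x \<bullet> y = (\<Sum>v\<in>B. (x \<bullet> v) *\<^sub>R v) \<bullet> y"
    using orthonormal_expand[OF assms] by simp
  then show ?thesis by (simp add: inner_sum_left inner_commute[of y])
qed

lemma orthonormal_basis_exists:
  fixes S :: "'a::euclidean_space set"
  assumes "subspace S"
  obtains B where "orthonormal B" "card B = dim S" "span B = S"
  using orthonormal_basis_subspace[OF assms] unfolding orthonormal_def by metis

lemma outer_mult_vec: "outer u v *v x = (v \<bullet> x) *\<^sub>R u"
  by (simp add: vec_eq_iff outer_def matrix_vector_mult_def inner_vec_def sum_distrib_right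
      mult.assoc mult.commute[of "u $ _"])

lemma inner_outer: "A \<bullet> outer u v = u \<bullet> (A *v v)"
  by (simp add: outer_def matrix_vector_mult_def inner_vec_def sum_distrib_left mult.left_commute)

lemma norm_outer: "norm (outer u v) = norm u * norm v"
  by (simp add: norm_eq_sqrt_inner inner_outer outer_mult_vec real_sqrt_mult)

lemma outer_scaleR: "outer (a *\<^sub>R u) (b *\<^sub>R v) = (a * b) *\<^sub>R outer u v"
  by (simp add: outer_def vec_eq_iff)

lemma linear_outer_left: "linear (\<lambda>u. outer u v)"
  by (rule linearI) (simp_all add: outer_def vec_eq_iff algebra_simps)

lemma linear_outer_right: "linear (outer u)"
  by (rule linearI) (simp_all add: outer_def vec_eq_iff algebra_simps)

lemma sum_matrix_vector_mult:
  "(\<Sum>i\<in>I. A i) *v x = (\<Sum>i\<in>I. (A i :: real^'p^'k) *v x)"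
  by (induction I rule: infinite_finite_induct) (simp_all add: matrix_vector_mult_add_rdistrib)

text \<open>The Frobenius inner product is the trace of \<open>W\<^sup>T A\<close>, so it can be evaluated in any
  orthonormal basis: apply Parseval's identity to each pair of rows.\<close>

lemma matrix_inner_basis:
  fixes A W :: "real^'p^'k"
  assumes B: "orthonormal B" "span B = UNIV"
  shows "W \<bullet> A = (\<Sum>v\<in>B. (W *v v) \<bullet> (A *v v))"
proof -
  have "W \<bullet> A = (\<Sum>i\<in>UNIV. W $ i \<bullet> A $ i)" by (simp add: inner_vec_def)
  also have "\<dots> = (\<Sum>i\<in>UNIV. \<Sum>v\<in>B. (W $ i \<bullet> v) * (A $ i \<bullet> v))"
    by (intro sum.cong refl orthonormal_parseval) (use B in auto)
  also have "\<dots> = (\<Sum>v\<in>B. (W *v v) \<bullet> (A *v v))"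
    by (subst sum.swap) (simp add: inner_vec_def matrix_vector_mult_def)
  finally show ?thesis .
qed

lemma matrix_expand_basis:
  fixes A :: "real^'p^'k"
  assumes B: "orthonormal B" "span B = UNIV"
  shows "A = (\<Sum>v\<in>B. outer (A *v v) v)"
proof -
  have "A *v x = (\<Sum>v\<in>B. outer (A *v v) v) *v x" for x
  proof -
    have "A *v x = A *v (\<Sum>v\<in>B. (x \<bullet> v) *\<^sub>R v)"
      using orthonormal_expand[OF B(1), of x] B(2) by simp
    also have "\<dots> = (\<Sum>v\<in>B. (x \<bullet> v) *\<^sub>R (A *v v))"
      by (simp add: linear_sum matrix_vector_mult_scaleR)
    finally show ?thesis by (simp add: sum_matrix_vector_mult outer_mult_vec inner_commute)
  qed
  then show ?thesis unfolding matrix_eq by blast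
qed

text \<open>In an orthonormal basis every term of the inner product vanishes. The condition holds, for
  instance, if the ranges of the two matrices are orthogonal.\<close>

lemma matrix_inner_zero:
  fixes A W :: "real^'p^'k"
  assumes "\<And>x. (W *v x) \<bullet> (A *v x) = 0"
  shows "W \<bullet> A = 0"
proof -
  obtain B :: "(real^'p) set" where "orthonormal B" "span B = UNIV"
    using orthonormal_basis_exists[of UNIV] by auto
  then show ?thesis using matrix_inner_basis[of B W A] assms by simp
qed

text \<open>\<open>D\<close> is the composition of \<open>E\<close> with the orthogonal projection onto the span of \<open>B\<close>, and such a
  composition does not increase the Frobenius norm because \<open>D\<close> is orthogonal to \<open>E - D\<close>.\<close>

lemma bessel_matrix:
  fixes E :: "real^'p^'k"
  assumes B: "orthonormal B" and D: "D = (\<Sum>v\<in>B. outer (E *v v) v)"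
  shows "(norm D)\<^sup>2 = (\<Sum>v\<in>B. (norm (E *v v))\<^sup>2)" "(norm D)\<^sup>2 \<le> (norm E)\<^sup>2"
proof -
  have Dv: "D *v v = E *v v" if "v \<in> B" for v
    unfolding D sum_matrix_vector_mult outer_mult_vec
    using orthonormal_inner[OF B] that orthonormal_finite[OF B]
    by (simp add: if_distrib[of "\<lambda>c. c *\<^sub>R _"] cong: if_cong)
  have F: "F \<bullet> D = (\<Sum>v\<in>B. (E *v v) \<bullet> (F *v v))" for F
    unfolding D by (simp add: inner_sum_right inner_outer)
  show 1: "(norm D)\<^sup>2 = (\<Sum>v\<in>B. (norm (E *v v))\<^sup>2)"
    unfolding power2_norm_eq_inner F by (intro sum.cong refl) (simp add: Dv)
  have 2: "E \<bullet> D = (norm D)\<^sup>2" unfolding 1 F by (simp add: power2_norm_eq_inner)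
  have "0 \<le> (norm (E - D))\<^sup>2" by simp
  also have "\<dots> = (norm E)\<^sup>2 - 2 * (E \<bullet> D) + (norm D)\<^sup>2"
    by (simp add: power2_norm_eq_inner algebra_simps inner_commute)
  finally show "(norm D)\<^sup>2 \<le> (norm E)\<^sup>2" using 2 by simp
qed

section \<open>The nuclear norm as a dual norm\<close>

lemma gram_inner:
  fixes A :: "real^'p^'k"
  shows "((transpose A ** A) *v x) \<bullet> y = (A *v x) \<bullet> (A *v y)"
  by (simp add: dot_lmul_matrix flip: matrix_vector_mul_assoc)

lemma subspace_eigenspace: "subspace (eigenspace A c)"
  unfolding eigenspace_def subspace_def
  by (auto simp: matrix_vector_right_distrib matrix_vector_mult_scaleR scaleR_right_distrib)

text \<open>The eigenvector is a unit vector of \<open>U\<close> at which \<open>norm (A *v x)\<close> is largest. The quadratic form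
  \<open>c * (norm z)\<^sup>2 - (norm (A *v z))\<^sup>2\<close>, where \<open>c\<close> is the squared maximum, is nonnegative on \<open>U\<close> and
  vanishes at \<open>x\<close>; hence its polarisation with \<open>x\<close> vanishes on \<open>U\<close>, which for an invariant \<open>U\<close> is
  the eigenvector equation.\<close>

lemma gram_eigenvector_in_invariant_subspace:
  fixes A :: "real^'p^'k"
  assumes U: "subspace U" "U \<noteq> {0}"
    and inv: "\<And>x. x \<in> U \<Longrightarrow> (transpose A ** A) *v x \<in> U"
  obtains x where "x \<in> U" "x \<noteq> 0" "x \<in> eigenspace (transpose A ** A) ((norm (A *v x))\<^sup>2)"
proof -
  let ?S = "U \<inter> sphere 0 1"
  have "compact ?S"
    using closed_subspace[OF U(1)] by (simp add: closed_Int_compact)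
  moreover have "?S \<noteq> {}"
  proof -
    obtain z where "z \<in> U" "z \<noteq> 0" using U subspace_0 by blast
    then have "z /\<^sub>R norm z \<in> ?S" using U(1) by (simp add: subspace_scale)
    then show ?thesis by blast
  qed
  moreover have "continuous_on ?S (\<lambda>x. norm (A *v x))"
    by (intro continuous_on_norm linear_continuous_on matrix_vector_mul_bounded_linear)
  ultimately obtain x where x: "x \<in> ?S" and max: "\<And>z. z \<in> ?S \<Longrightarrow> norm (A *v z) \<le> norm (A *v x)"
    using continuous_attains_sup by meson
  define c where "c = (norm (A *v x))\<^sup>2"
  define b where "b y z = c * (y \<bullet> z) - (A *v y) \<bullet> (A *v z)" for y z
  have nonneg: "0 \<le> b z z" if "z \<in> U" for z
  proof (cases "z = 0")
    case False
    then have "z /\<^sub>R norm z \<in> ?S" using that U(1) by (simp add: subspace_scale)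
    from max[OF this] have "norm (A *v z) / norm z \<le> norm (A *v x)"
      by (simp add: matrix_vector_mult_scaleR divide_inverse mult.commute)
    then have "norm (A *v z) \<le> norm (A *v x) * norm z" using False by (simp add: field_simps)
    then have "(norm (A *v z))\<^sup>2 \<le> (norm (A *v x) * norm z)\<^sup>2" by (intro power_mono) auto
    then show ?thesis by (simp add: b_def c_def power_mult_distrib flip: power2_norm_eq_inner)
  qed (simp add: b_def)
  have bx: "b x x = 0" using x by (simp add: b_def c_def norm_eq_1 power2_norm_eq_inner)
  have zero: "b x w = 0" if w: "w \<in> U" for w
  proof -
    have "0 \<le> 2 * t * b x w + t\<^sup>2 * b w w" for t
    proof -
      have "0 \<le> b (x + t *\<^sub>R w) (x + t *\<^sub>R w)"
        using x w U(1) by (intro nonneg) (simp add: subspace_add subspace_scale)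
      also have "\<dots> = b x x + 2 * t * b x w + t\<^sup>2 * b w w"
        by (simp add: b_def matrix_vector_right_distrib matrix_vector_mult_scaleR inner_simps
            inner_commute algebra_simps power2_eq_square)
      finally show ?thesis using bx by simp
    qed
    note * = this
    \<comment> \<open>A quadratic polynomial in \<open>t\<close> without constant term is nonnegative only if its linear term
      vanishes; \<open>t = - b x w / d\<close> refutes the contrary, where adding 1 avoids division by zero.\<close>
    show ?thesis
    proof (rule ccontr)
      assume nz: "b x w \<noteq> 0"
      define d where "d = b w w + 1"
      have d: "d > 0" using nonneg[OF w] by (simp add: d_def)
      have "2 * (- b x w / d) * b x w + (- b x w / d)\<^sup>2 * b w w
          = (b x w)\<^sup>2 / d\<^sup>2 * (b w w - 2 * d)"
        using d by (simp add: field_simps power2_eq_square)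
      also have "\<dots> < 0"
        using nz d by (intro mult_pos_neg) (auto simp: d_def)
      finally show False using *[of "- b x w / d"] by simp
    qed
  qed
  define g where "g = (transpose A ** A) *v x - c *\<^sub>R x"
  have gU: "g \<in> U" using x U(1) inv by (simp add: g_def subspace_diff subspace_scale)
  have "g \<bullet> g = - b x g"
    unfolding g_def b_def by (subst (1) inner_diff_left) (simp add: gram_inner)
  then have "g = 0" using zero[OF gU] by simp
  then have "x \<in> eigenspace (transpose A ** A) ((norm (A *v x))\<^sup>2)"
    by (simp add: g_def eigenspace_def c_def)
  moreover have "x \<in> U" "x \<noteq> 0" using x by auto
  ultimately show ?thesis by (intro that)
qed

text \<open>The right singular vectors. The definition of the nuclear norm speaks of eigenspaces of the Gram
  matrix, so orthonormal bases of these eigenspaces are united; eigenspaces to different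
  eigenvalues are orthogonal. If the union did not span the space, its orthogonal complement would be
  a nonzero invariant subspace and contain one more eigenvector. On the eigenspace of \<open>s\<^sup>2\<close> the matrix
  stretches every vector by the factor \<open>s\<close>, so the dimensions in the definition count each
  singular value as often as it occurs in the sum over the basis.\<close>

lemma singular_basis:
  fixes A :: "real^'p^'k"
  obtains B where "orthonormal B" "span B = UNIV"
    "pairwise (\<lambda>v w. orthogonal (A *v v) (A *v w)) B"
    "nuclear_norm A = (\<Sum>v\<in>B. norm (A *v v))"
proof -
  let ?G = "transpose A ** A" and ?S = "singular_values A"
  let ?E = "\<lambda>s. eigenspace (transpose A ** A) (s\<^sup>2)"
  have "\<exists>B. orthonormal B \<and> card B = dim (?E s) \<and> span B = ?E s" for s
    using orthonormal_basis_exists[OF subspace_eigenspace, of ?G "s\<^sup>2"] by metis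
  then obtain b where b: "\<And>s. orthonormal (b s)" "\<And>s. card (b s) = dim (?E s)"
    "\<And>s. span (b s) = ?E s" by metis
  have bE: "?G *v v = s\<^sup>2 *\<^sub>R v" if "v \<in> b s" for s v
    using b(3)[of s] span_base[OF that] by (simp add: eigenspace_def)
  have bn: "norm v = 1" if "v \<in> b s" for s v using b(1)[of s] that by (simp add: orthonormal_def)
  have Sn: "s \<ge> 0" if "s \<in> ?S" for s using that by (simp add: singular_values_def)
  have Ab: "(A *v v) \<bullet> (A *v w) = s\<^sup>2 * (v \<bullet> w)" if "v \<in> b s" for s v w
    using bE[OF that] gram_inner[of A v w] by simp
  have orth: "v \<bullet> w = 0" if "v \<in> b s" "w \<in> b t" "s \<in> ?S" "t \<in> ?S" "s \<noteq> t" for s t v w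
  proof -
    have "s\<^sup>2 * (v \<bullet> w) = t\<^sup>2 * (v \<bullet> w)"
      using Ab[OF that(1), of w] Ab[OF that(2), of v] by (simp add: inner_commute)
    moreover have "s\<^sup>2 \<noteq> t\<^sup>2" using that Sn by (auto simp: power2_eq_iff_nonneg)
    ultimately show ?thesis by simp
  qed
  define B where "B = (\<Union>s\<in>?S. b s)"
  have on: "orthonormal B"
    unfolding orthonormal_def pairwise_def orthogonal_def
  proof (intro conjI ballI impI)
    fix v w assume "v \<in> B" "w \<in> B" "v \<noteq> w"
    then obtain s t where "s \<in> ?S" "t \<in> ?S" "v \<in> b s" "w \<in> b t" by (auto simp: B_def)
    then show "v \<bullet> w = 0"
      using orth orthonormal_inner[OF b(1)] \<open>v \<noteq> w\<close> by (cases "s = t") auto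
  qed (auto simp: B_def bn)
  have disj: "b s \<inter> b t = {}" if "s \<in> ?S" "t \<in> ?S" "s \<noteq> t" for s t
  proof -
    have "v \<bullet> v \<noteq> 0" if "v \<in> b s" for v using bn[OF that] by auto
    then show ?thesis using orth that by blast
  qed
  have span: "span B = UNIV"
  proof (rule ccontr)
    assume "span B \<noteq> UNIV"
    then have "dim B < DIM(real^'p)"
      by (metis dim_eq_full dim_subset_UNIV le_neq_implies_less)
    then obtain z where z: "z \<noteq> 0" "\<And>y. y \<in> span B \<Longrightarrow> orthogonal z y"
      by (rule orthogonal_to_subspace_exists) auto
    define U where "U = {x. \<forall>v\<in>B. x \<bullet> v = 0}"
    have "subspace U" by (auto simp: subspace_def U_def inner_simps)
    moreover have "U \<noteq> {0}" using z by (auto simp: U_def orthogonal_def span_base)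
    moreover have "?G *v x \<in> U" if x: "x \<in> U" for x
    proof -
      have "(?G *v x) \<bullet> v = 0" if v: "v \<in> B" for v
      proof -
        obtain s where "v \<in> b s" using v by (auto simp: B_def)
        then show ?thesis using Ab[of v s x] x v unfolding gram_inner U_def
          by (simp add: inner_commute)
      qed
      then show ?thesis by (simp add: U_def)
    qed
    ultimately obtain x where x: "x \<in> U" "x \<noteq> 0" "x \<in> ?E (norm (A *v x))"
      by (rule gram_eigenvector_in_invariant_subspace[of U A])
    then have "norm (A *v x) \<in> ?S" by (auto simp: singular_values_def)
    then have "b (norm (A *v x)) \<subseteq> B" by (auto simp: B_def)
    then have "x \<in> span B" using b(3) x(3) span_mono by blast
    then have "x \<bullet> x = 0"
      using orthonormal_parseval[OF on, of x x] x(1) by (simp add: U_def)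
    then show False using x(2) by simp
  qed
  have nA: "norm (A *v v) = s" if "v \<in> b s" "s \<in> ?S" for s v
    using Ab[OF that(1), of v] bn[OF that(1)] Sn[OF that(2)]
    by (simp add: norm_eq_sqrt_inner)
  have "(\<Sum>v\<in>B. norm (A *v v)) = (\<Sum>s\<in>?S. \<Sum>v\<in>b s. norm (A *v v))"
    unfolding B_def
    by (rule sum.UNION_disjoint)
      (use finite_singular_values orthonormal_finite[OF b(1)] disj in auto)
  also have "\<dots> = nuclear_norm A"
    unfolding nuclear_norm_def by (intro sum.cong refl) (simp add: nA b)
  finally have nn: "nuclear_norm A = (\<Sum>v\<in>B. norm (A *v v))" by simp
  have "(A *v v) \<bullet> (A *v w) = 0" if vw: "v \<in> B" "w \<in> B" "v \<noteq> w" for v w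
  proof -
    obtain s where "v \<in> b s" using vw by (auto simp: B_def)
    then show ?thesis using Ab[of v s w] orthonormal_inner[OF on vw(1,2)] vw(3) by simp
  qed
  then have "pairwise (\<lambda>v w. orthogonal (A *v v) (A *v w)) B"
    by (simp add: pairwise_def orthogonal_def)
  from that[OF on span this nn] show ?thesis .
qed

text \<open>One half of the duality between nuclear norm and operator norm: the inner product is evaluated in
  the basis of right singular vectors, term by term with the Cauchy-Schwarz inequality.\<close>

lemma inner_le_nuclear_norm:
  fixes A W :: "real^'p^'k"
  assumes "\<And>x. norm (W *v x) \<le> norm x"
  shows "W \<bullet> A \<le> nuclear_norm A"
proof -
  obtain B where B: "orthonormal B" "span B = UNIV" and
    nn: "nuclear_norm A = (\<Sum>v\<in>B. norm (A *v v))" by (rule singular_basis[of A])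
  have "(W *v v) \<bullet> (A *v v) \<le> norm (A *v v)" if "v \<in> B" for v
  proof -
    have "(W *v v) \<bullet> (A *v v) \<le> norm (W *v v) * norm (A *v v)" by (rule norm_cauchy_schwarz)
    also have "\<dots> \<le> 1 * norm (A *v v)"
      using assms[of v] B(1) that by (intro mult_right_mono) (auto simp: orthonormal_def)
    finally show ?thesis by simp
  qed
  then show ?thesis unfolding nn matrix_inner_basis[OF B(1,2), of W A] by (rule sum_mono)
qed

text \<open>The other half: \<open>W\<close> is the partial isometry of the polar decomposition of \<open>A\<close>, which maps each
  right singular vector \<open>v\<close> to the direction of \<open>A *v v\<close> and vanishes on the kernel of \<open>A\<close>. The last two
  properties allow the polar factors of two matrices with orthogonal row and column spaces to be added
  without increasing the operator norm.\<close>

lemma polar_factor: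
  fixes A :: "real^'p^'k"
  obtains W where "\<And>x. norm (W *v x) \<le> norm x" "W \<bullet> A = nuclear_norm A"
    "\<And>z. A *v z = 0 \<Longrightarrow> W *v z = 0" "\<And>x. W *v x \<in> range ((*v) A)"
proof -
  obtain B where B: "orthonormal B" "span B = UNIV"
    "pairwise (\<lambda>v w. orthogonal (A *v v) (A *v w)) B"
    "nuclear_norm A = (\<Sum>v\<in>B. norm (A *v v))" by (rule singular_basis[of A])
  have AB: "(A *v v) \<bullet> (A *v w) = 0" if "v \<in> B" "w \<in> B" "v \<noteq> w" for v w
    using B(3) that by (simp add: pairwise_def orthogonal_def)
  note fin = orthonormal_finite[OF B(1)]
  define W where "W = (\<Sum>v\<in>B. outer (sgn (A *v v)) v)"
  have Wx: "W *v x = (\<Sum>v\<in>B. (x \<bullet> v) *\<^sub>R sgn (A *v v))" for x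
    by (simp add: W_def sum_matrix_vector_mult outer_mult_vec inner_commute)
  have sg: "sgn (A *v v) \<bullet> sgn (A *v w) = (if v = w \<and> A *v v \<noteq> 0 then 1 else 0)"
    if "v \<in> B" "w \<in> B" for v w
  proof (cases "v = w")
    case True
    then show ?thesis using norm_sgn[of "A *v v"] by (simp add: norm_eq_1 split: if_splits)
  next
    case False
    then show ?thesis using AB[OF that] by (simp add: sgn_div_norm)
  qed
  have Ax: "A *v x = (\<Sum>v\<in>B. (x \<bullet> v) *\<^sub>R (A *v v))" for x
  proof -
    have "A *v x = A *v (\<Sum>v\<in>B. (x \<bullet> v) *\<^sub>R v)"
      using orthonormal_expand[OF B(1), of x] B(2) by simp
    then show ?thesis by (simp add: linear_sum matrix_vector_mult_scaleR)
  qed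
  have "norm (W *v x) \<le> norm x" for x
  proof -
    have "(norm (W *v x))\<^sup>2 = (\<Sum>v\<in>B. \<Sum>w\<in>B. (x \<bullet> v) * (x \<bullet> w) * (sgn (A *v w) \<bullet> sgn (A *v v)))"
      unfolding power2_norm_eq_inner Wx by (simp add: inner_sum_left inner_sum_right sum_distrib_left ac_simps)
    also have "\<dots> = (\<Sum>v\<in>B. \<Sum>w\<in>B. if w = v then if A *v v \<noteq> 0 then (x \<bullet> v)\<^sup>2 else 0 else 0)"
      by (intro sum.cong refl) (simp add: sg power2_eq_square)
    also have "\<dots> = (\<Sum>v\<in>B. if A *v v \<noteq> 0 then (x \<bullet> v)\<^sup>2 else 0)"
      using fin by simp
    also have "\<dots> \<le> (\<Sum>v\<in>B. (x \<bullet> v)\<^sup>2)" by (intro sum_mono) auto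
    also have "\<dots> = (norm x)\<^sup>2"
      unfolding power2_norm_eq_inner unfolding power2_eq_square
      using orthonormal_parseval[OF B(1), of x x] B(2) by simp
    finally show ?thesis by (simp add: power2_le_iff_abs_le)
  qed
  moreover have "W \<bullet> A = nuclear_norm A"
  proof -
    have "A \<bullet> W = (\<Sum>v\<in>B. sgn (A *v v) \<bullet> (A *v v))"
      unfolding W_def by (simp add: inner_sum_right inner_outer)
    also have "\<dots> = (\<Sum>v\<in>B. norm (A *v v))"
    proof (intro sum.cong refl)
      show "sgn (A *v v) \<bullet> (A *v v) = norm (A *v v)" for v
        by (cases "A *v v = 0")
          (auto simp: sgn_div_norm power2_norm_eq_inner[symmetric] power2_eq_square)
    qed
    finally show ?thesis by (simp add: B(4) inner_commute)
  qed
  moreover have "W *v z = 0" if z: "A *v z = 0" for z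
  proof -
    have "(z \<bullet> v) *\<^sub>R sgn (A *v v) = 0" if v: "v \<in> B" for v
    proof -
      have "0 = (A *v z) \<bullet> (A *v v)" using z by simp
      also have "\<dots> = (\<Sum>w\<in>B. (z \<bullet> w) * ((A *v w) \<bullet> (A *v v)))"
        by (subst Ax) (simp add: inner_sum_left)
      also have "\<dots> = (\<Sum>w\<in>B. if w = v then (z \<bullet> v) * ((A *v v) \<bullet> (A *v v)) else 0)"
        using v AB by (intro sum.cong) auto
      also have "\<dots> = (z \<bullet> v) * ((A *v v) \<bullet> (A *v v))" using fin v by simp
      finally show ?thesis by (auto simp: sgn_zero_iff)
    qed
    then show ?thesis unfolding Wx by (intro sum.neutral ballI)
  qed
  moreover have "W *v x \<in> range ((*v) A)" for x
  proof -
    have "subspace (range ((*v) A))" by (intro linear_subspace_image) auto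
    moreover have "sgn (A *v v) \<in> range ((*v) A)" for v
      by (auto simp: sgn_div_norm intro!: image_eqI[of _ _ "v /\<^sub>R norm (A *v v)"]
          simp: matrix_vector_mult_scaleR)
    ultimately show ?thesis unfolding Wx by (intro subspace_sum subspace_scale)
  qed
  ultimately show ?thesis by (rule that)
qed
section \<open>Descent directions of the nuclear norm\<close>

text \<open>Since \<open>C\<close> contains 0, the total weight may stay below \<open>T\<close>: the missing weight is put on 0.\<close>

lemma sum_in_scaled_convex:
  fixes C :: "'a::real_vector set"
  assumes C: "convex C" "0 \<in> C" and x: "\<And>i. i \<in> I \<Longrightarrow> x i \<in> C"
    and t: "\<And>i. i \<in> I \<Longrightarrow> 0 \<le> t i" "(\<Sum>i\<in>I. t i) \<le> T"
  shows "\<exists>c\<in>C. (\<Sum>i\<in>I. t i *\<^sub>R x i) = T *\<^sub>R c"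
proof (cases "finite I \<and> (\<Sum>i\<in>I. t i) > 0")
  case True
  define \<tau> where "\<tau> = (\<Sum>i\<in>I. t i)"
  define c where "c = (\<Sum>i\<in>I. (t i / \<tau>) *\<^sub>R x i)"
  have \<tau>: "0 < \<tau>" "\<tau> \<le> T" using True t by (auto simp: \<tau>_def)
  have "c \<in> C" unfolding c_def
    using True t \<tau> x by (intro convex_sum C) (auto simp: \<tau>_def simp flip: sum_divide_distrib)
  then have "(\<tau> / T) *\<^sub>R c + (1 - \<tau> / T) *\<^sub>R 0 \<in> C"
    using \<tau> C by (intro convexD) auto
  moreover have "(\<Sum>i\<in>I. t i *\<^sub>R x i) = T *\<^sub>R ((\<tau> / T) *\<^sub>R c + (1 - \<tau> / T) *\<^sub>R 0)"
    using \<tau> by (simp add: c_def scaleR_sum_right)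
  ultimately show ?thesis by blast
next
  case False
  have "(\<Sum>i\<in>I. t i *\<^sub>R x i) = 0"
  proof (cases "finite I")
    case True
    then have "t i = 0" if "i \<in> I" for i
      using False t(1) that sum_nonneg[of I t] sum_nonneg_eq_0_iff[of I t] by force
    then show ?thesis by simp
  qed simp
  then show ?thesis using C(2) by force
qed

text \<open>A descent direction is dominated by its part that lives on the column or row space of
  \<open>\<Theta>\<close>, and that part has low rank. Split \<open>\<Delta> = D1 + D2 + D3\<close>, where \<open>D1\<close> is the projection of
  the columns onto the column space of \<open>\<Theta>\<close>, \<open>D2\<close> the projection of the rows of the rest onto its
  row space, and \<open>D3\<close> is orthogonal to both spaces. Let \<open>W0\<close> and \<open>W1\<close> be the polar factors of
  \<open>\<Theta>\<close> and \<open>D3\<close>. Their sum is a contraction, so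
  duality bounds \<open>nuclear_norm (\<Theta> + \<Delta>)\<close> from below by
  \<open>nuclear_norm \<Theta> + W0 \<bullet> D1 + nuclear_norm D3\<close>, and for a descent direction the nuclear norm of
  \<open>D3\<close> is at most \<open>- (W0 \<bullet> D1)\<close>.

  Written as sums of rank-one matrices over orthonormal bases of the column and the row space, \<open>D1\<close>
  and \<open>D2\<close> have weights \<open>\<alpha>\<close> and \<open>\<beta>\<close>, which Cauchy-Schwarz bounds by \<open>sqrt r\<close> times the Frobenius
  norms \<open>a\<close> and \<open>b\<close>; \<open>D3\<close> adds at most another \<open>\<alpha>\<close>. The constant 5 comes from
  \<open>2 * a + b \<le> sqrt (5 * (a\<^sup>2 + b\<^sup>2))\<close>.\<close>

lemma descent_direction_atomic:
  fixes \<Theta> \<Delta> :: "real^'p^'k" and C :: "(real^'p^'k) set"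
  assumes le: "nuclear_norm (\<Theta> + \<Delta>) \<le> nuclear_norm \<Theta>"
    and C: "convex C" "0 \<in> C" "\<And>u v. norm u \<le> 1 \<Longrightarrow> norm v \<le> 1 \<Longrightarrow> outer u v \<in> C"
  shows "\<exists>c\<in>C. \<Delta> = (sqrt (5 * rank \<Theta>) * norm \<Delta>) *\<^sub>R c"
proof -
  define r where "r = real (rank \<Theta>)"
  have "subspace (range ((*v) \<Theta>))" "subspace (range ((*v) (transpose \<Theta>)))"
    by (intro linear_subspace_image matrix_vector_mul_linear subspace_UNIV)+
  then obtain U V where
    U: "orthonormal U" "card U = rank \<Theta>" "span U = range ((*v) \<Theta>)" and
    V: "orthonormal V" "card V = rank \<Theta>" "span V = range ((*v) (transpose \<Theta>))"
    using orthonormal_basis_exists[of "range ((*v) \<Theta>)"]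
      orthonormal_basis_exists[of "range ((*v) (transpose \<Theta>))"]
      rank_dim_range[of \<Theta>] rank_dim_range[of "transpose \<Theta>"] rank_transpose[of \<Theta>]
    by metis
  note finU = orthonormal_finite[OF U(1)] and finV = orthonormal_finite[OF V(1)]
  have \<Theta>0: "\<Theta> *v x = 0" if "\<And>v. v \<in> V \<Longrightarrow> v \<bullet> x = 0" for x
  proof -
    have "transpose \<Theta> *v (\<Theta> *v x) \<in> span V" by (simp add: V del: transpose_matrix_vector)
    from orthonormal_parseval[OF V(1) this, of x]
    have "(transpose \<Theta> *v (\<Theta> *v x)) \<bullet> x = 0"
      using that by (simp add: inner_commute[of x] del: transpose_matrix_vector)
    then show ?thesis by (simp add: dot_lmul_matrix)
  qed
  define D1 where "D1 = (\<Sum>u\<in>U. outer u (u v* \<Delta>))"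
  define E where "E = \<Delta> - D1"
  define D2 where "D2 = (\<Sum>v\<in>V. outer (E *v v) v)"
  define D3 where "D3 = E - D2"
  have uE: "u \<bullet> (E *v x) = 0" if u: "u \<in> U" for u x
  proof -
    have "u \<bullet> (D1 *v x) = (\<Sum>w\<in>U. if w = u then (u v* \<Delta>) \<bullet> x else 0)"
      unfolding D1_def sum_matrix_vector_mult outer_mult_vec inner_sum_right
      by (intro sum.cong) (auto simp: orthonormal_inner[OF U(1)] u)
    then show ?thesis using finU u
      by (simp add: E_def matrix_vector_mult_diff_rdistrib inner_diff_right dot_lmul_matrix)
  qed
  have D2x: "D2 *v x = (\<Sum>v\<in>V. (v \<bullet> x) *\<^sub>R (E *v v))" for x
    by (simp add: D2_def sum_matrix_vector_mult outer_mult_vec)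
  have D3v: "D3 *v v = 0" if v: "v \<in> V" for v
  proof -
    have "D2 *v v = (\<Sum>w\<in>V. if w = v then E *v v else 0)"
      unfolding D2x by (intro sum.cong) (auto simp: orthonormal_inner[OF V(1)] v)
    then show ?thesis using finV v by (simp add: D3_def matrix_vector_mult_diff_rdistrib)
  qed
  have uD3: "u \<bullet> (D3 *v x) = 0" if "u \<in> U" for u x
    using uE[OF that]
    by (simp add: D3_def D2x matrix_vector_mult_diff_rdistrib inner_diff_right inner_sum_right)
  have UE: "y \<bullet> (E *v x) = 0" and UD3: "y \<bullet> (D3 *v x) = 0" if "y \<in> span U" for x y
    using orthonormal_parseval[OF U(1) that, of "E *v x"]
      orthonormal_parseval[OF U(1) that, of "D3 *v x"] uE uD3 by (simp_all add: inner_commute)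
  obtain W0 where W0: "\<And>x. norm (W0 *v x) \<le> norm x" "W0 \<bullet> \<Theta> = nuclear_norm \<Theta>"
    "\<And>z. \<Theta> *v z = 0 \<Longrightarrow> W0 *v z = 0" "\<And>x. W0 *v x \<in> range ((*v) \<Theta>)"
    using polar_factor[of \<Theta>] by blast
  obtain W1 where W1: "\<And>x. norm (W1 *v x) \<le> norm x" "W1 \<bullet> D3 = nuclear_norm D3"
    "\<And>z. D3 *v z = 0 \<Longrightarrow> W1 *v z = 0" "\<And>x. W1 *v x \<in> range ((*v) D3)"
    using polar_factor[of D3] by blast
  have UW1: "y \<bullet> (W1 *v x) = 0" if "y \<in> span U" for x y
    using W1(4)[of x] UD3[OF that] by auto
  \<comment> \<open>\<open>W0\<close> sees only the part \<open>y\<close> of \<open>x\<close> in the row space of \<open>\<Theta>\<close>, and \<open>W1\<close> only the part orthogonal to it;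
    their values are orthogonal, so Pythagoras applies on both sides.\<close>
  have contr: "norm ((W0 + W1) *v x) \<le> norm x" for x
  proof -
    define y where "y = (\<Sum>v\<in>V. (x \<bullet> v) *\<^sub>R v)"
    have vy: "v \<bullet> (x - y) = 0" if v: "v \<in> V" for v
    proof -
      have "v \<bullet> y = (\<Sum>w\<in>V. if w = v then x \<bullet> v else 0)"
        unfolding y_def inner_sum_right
        by (intro sum.cong) (auto simp: orthonormal_inner[OF V(1)] v)
      then show ?thesis using finV v by (simp add: inner_diff_right inner_commute)
    qed
    have "W0 *v (x - y) = 0" by (intro W0(3) \<Theta>0 vy)
    then have 0: "W0 *v x = W0 *v y" by (simp add: matrix_vector_mult_diff_distrib)
    have "D3 *v y = 0"
      unfolding y_def by (simp add: linear_sum matrix_vector_mult_scaleR D3v)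
    then have "W1 *v y = 0" by (rule W1(3))
    then have 1: "W1 *v x = W1 *v (x - y)" by (simp add: matrix_vector_mult_diff_distrib)
    have y0: "y \<bullet> (x - y) = 0"
      unfolding y_def[symmetric] by (subst (1) y_def) (simp add: inner_sum_left vy)
    have "W0 *v x \<in> span U" using W0(4) U(3) by simp
    then have "(norm ((W0 + W1) *v x))\<^sup>2 = (norm (W0 *v y))\<^sup>2 + (norm (W1 *v (x - y)))\<^sup>2"
      unfolding matrix_vector_mult_add_rdistrib 0[symmetric] 1[symmetric]
      by (intro norm_add_Pythagorean) (simp add: orthogonal_def UW1)
    also have "\<dots> \<le> (norm y)\<^sup>2 + (norm (x - y))\<^sup>2"
      by (intro add_mono power_mono W0 W1) auto
    also have "\<dots> = (norm (y + (x - y)))\<^sup>2"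
      by (intro norm_add_Pythagorean[symmetric]) (simp add: orthogonal_def y0)
    finally show ?thesis by (simp add: power2_le_iff_abs_le)
  qed
  define \<alpha> where "\<alpha> = (\<Sum>u\<in>U. norm (u v* \<Delta>))"
  define \<beta> where "\<beta> = (\<Sum>v\<in>V. norm (E *v v))"
  have "W0 \<bullet> D1 \<ge> - \<alpha>"
  proof -
    have "- norm (u v* \<Delta>) \<le> W0 \<bullet> outer u (u v* \<Delta>)" if "u \<in> U" for u
    proof -
      have "\<bar>u \<bullet> (W0 *v (u v* \<Delta>))\<bar> \<le> norm u * norm (W0 *v (u v* \<Delta>))"
        by (rule Cauchy_Schwarz_ineq2)
      also have "\<dots> \<le> 1 * norm (u v* \<Delta>)"
        using U(1) that by (intro mult_mono W0) (auto simp: orthonormal_def)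
      finally show ?thesis by (simp add: inner_outer)
    qed
    then show ?thesis unfolding \<alpha>_def D1_def inner_sum_right sum_negf[symmetric] by (rule sum_mono)
  qed
  moreover have "W0 \<bullet> E = 0"
    using W0(4) U(3) UE by (intro matrix_inner_zero) auto
  moreover have "W1 \<bullet> \<Theta> = 0"
    using UW1 U(3) by (subst inner_commute) (auto intro!: matrix_inner_zero)
  moreover have "W1 \<bullet> D1 = 0"
    unfolding D1_def inner_sum_right inner_outer by (intro sum.neutral ballI UW1 span_base)
  moreover have "W1 \<bullet> D2 = 0"
    unfolding D2_def inner_sum_right inner_outer by (simp add: W1(3) D3v)
  moreover have "\<Delta> = D1 + E" by (simp add: E_def)
  moreover have "E = D2 + D3" by (simp add: D3_def)
  moreover have "(W0 + W1) \<bullet> (\<Theta> + \<Delta>) \<le> nuclear_norm \<Theta>"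
    using inner_le_nuclear_norm[OF contr] le by (rule order_trans)
  ultimately have D3\<alpha>: "nuclear_norm D3 \<le> \<alpha>"
    using W0(2) W1(2) by (simp add: inner_add_left inner_add_right)
  obtain B where B: "orthonormal B" "span B = UNIV" and
    nn: "nuclear_norm D3 = (\<Sum>v\<in>B. norm (D3 *v v))" by (rule singular_basis[of D3])
  note finB = orthonormal_finite[OF B(1)]
  have cauchy: "(\<Sum>i\<in>I. f i) \<le> sqrt (card I) * sqrt (\<Sum>i\<in>I. (f i)\<^sup>2)"
    for I :: "'x set" and f :: "'x \<Rightarrow> real"
  proof -
    have "(\<Sum>i\<in>I. f i)\<^sup>2 \<le> card I * (\<Sum>i\<in>I. (f i)\<^sup>2)"
      using sum_squared_le_sum_of_squares[of f I] by (simp add: mult.commute)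
    then show ?thesis by (simp add: real_le_rsqrt flip: real_sqrt_mult)
  qed
  define a where "a = norm D1"
  define b where "b = norm D2"
  have D1t: "(\<Sum>u\<in>U. (norm (u v* \<Delta>))\<^sup>2) = a\<^sup>2"
  proof -
    have "E \<bullet> D1 = 0"
      unfolding D1_def inner_sum_right inner_outer by (simp add: uE)
    then have "D1 \<bullet> D1 = \<Delta> \<bullet> D1" by (simp add: E_def inner_diff_left)
    also have "\<dots> = (\<Sum>u\<in>U. (norm (u v* \<Delta>))\<^sup>2)"
      by (subst D1_def)
        (simp add: inner_sum_right inner_outer power2_norm_eq_inner flip: dot_lmul_matrix)
    finally show ?thesis by (simp add: a_def power2_norm_eq_inner)
  qed
  have "\<alpha> \<le> sqrt r * a"
    unfolding \<alpha>_def using cauchy[of "\<lambda>u. norm (u v* \<Delta>)" U] D1t U(2)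
    by (simp add: r_def a_def)
  moreover have "\<beta> \<le> sqrt r * b"
    unfolding \<beta>_def using cauchy[of "\<lambda>v. norm (E *v v)" V] bessel_matrix(1)[OF V(1) D2_def, symmetric] V(2)
    by (simp add: r_def b_def)
  moreover have ab: "a\<^sup>2 + b\<^sup>2 \<le> (norm \<Delta>)\<^sup>2"
  proof -
    have "D1 \<bullet> E = 0"
      unfolding D1_def inner_sum_left by (subst inner_commute) (simp add: inner_outer uE)
    then have "(norm \<Delta>)\<^sup>2 = a\<^sup>2 + (norm E)\<^sup>2"
      unfolding a_def \<open>\<Delta> = D1 + E\<close> by (intro norm_add_Pythagorean) (simp add: orthogonal_def)
    then show ?thesis using bessel_matrix(2)[OF V(1) D2_def] by (simp add: b_def)
  qed
  ultimately have weight: "\<alpha> + \<beta> + \<alpha> \<le> sqrt r * (2 * a + b)" by (simp add: algebra_simps)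
  have "2 * a + b \<le> sqrt 5 * norm \<Delta>"
  proof -
    have "(2 * a + b)\<^sup>2 \<le> 5 * (a\<^sup>2 + b\<^sup>2)"
      using zero_le_power2[of "a - 2 * b"] by (simp add: power2_eq_square algebra_simps)
    also have "\<dots> \<le> 5 * (norm \<Delta>)\<^sup>2" using ab by (intro mult_left_mono) auto
    finally have "2 * a + b \<le> sqrt (5 * (norm \<Delta>)\<^sup>2)" by (rule real_le_rsqrt)
    then show ?thesis by (simp add: real_sqrt_mult)
  qed
  then have "sqrt r * (2 * a + b) \<le> sqrt r * (sqrt 5 * norm \<Delta>)"
    by (intro mult_left_mono) (auto simp: r_def)
  with weight have weight: "\<alpha> + \<beta> + \<alpha> \<le> sqrt (5 * rank \<Theta>) * norm \<Delta>"
    by (simp add: r_def real_sqrt_mult ac_simps)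
  have sgn_le: "norm (sgn w) \<le> 1" for w :: "'x::real_normed_vector" by (simp add: norm_sgn)
  have sgn_mult: "norm w *\<^sub>R sgn w = w" for w :: "'x::real_normed_vector"
    by (cases "w = 0") (simp_all add: sgn_div_norm)
  have "\<exists>c\<in>C. (\<Sum>u\<in>U. norm (u v* \<Delta>) *\<^sub>R outer u (sgn (u v* \<Delta>))) = \<alpha> *\<^sub>R c"
    using U(1) by (intro sum_in_scaled_convex C sgn_le) (auto simp: \<alpha>_def orthonormal_def)
  moreover have "(\<Sum>u\<in>U. norm (u v* \<Delta>) *\<^sub>R outer u (sgn (u v* \<Delta>))) = D1"
    unfolding D1_def by (intro sum.cong refl)
      (metis linear_outer_right linear_scale sgn_mult)
  ultimately obtain c1 where c1: "c1 \<in> C" "D1 = \<alpha> *\<^sub>R c1" by auto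
  have outer_sgn: "norm w *\<^sub>R outer (sgn w) v = outer w v" for w v
    by (metis linear_outer_left linear_scale sgn_mult)
  have "\<exists>c\<in>C. (\<Sum>v\<in>V. norm (E *v v) *\<^sub>R outer (sgn (E *v v)) v) = \<beta> *\<^sub>R c"
    using V(1) by (intro sum_in_scaled_convex C sgn_le) (auto simp: \<beta>_def orthonormal_def)
  then obtain c2 where c2: "c2 \<in> C" "D2 = \<beta> *\<^sub>R c2" by (auto simp: D2_def outer_sgn)
  have "\<exists>c\<in>C. (\<Sum>v\<in>B. norm (D3 *v v) *\<^sub>R outer (sgn (D3 *v v)) v) = \<alpha> *\<^sub>R c"
    using B(1) D3\<alpha> by (intro sum_in_scaled_convex C sgn_le) (auto simp: nn orthonormal_def)
  then obtain c3 where c3: "c3 \<in> C" "D3 = \<alpha> *\<^sub>R c3"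
    using matrix_expand_basis[OF B, of D3] by (auto simp: outer_sgn)
  have "\<alpha> \<ge> 0" "\<beta> \<ge> 0" by (simp_all add: \<alpha>_def \<beta>_def sum_nonneg)
  have "\<exists>c\<in>C. (\<Sum>i\<in>{0,1,2::nat}. [\<alpha>, \<beta>, \<alpha>] ! i *\<^sub>R [c1, c2, c3] ! i)
      = (sqrt (5 * rank \<Theta>) * norm \<Delta>) *\<^sub>R c"
    using c1 c2 c3 weight \<open>\<alpha> \<ge> 0\<close> \<open>\<beta> \<ge> 0\<close> by (intro sum_in_scaled_convex C) auto
  moreover have "(\<Sum>i\<in>{0,1,2::nat}. [\<alpha>, \<beta>, \<alpha>] ! i *\<^sub>R [c1, c2, c3] ! i) = \<Delta>"
    using c1 c2 c3 \<open>\<Delta> = D1 + E\<close> \<open>E = D2 + D3\<close> by simp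
  ultimately show ?thesis by simp
qed
section \<open>A finite set of rank-one atoms\<close>

text \<open>Volume comparison: the balls of radius \<open>\<epsilon> / 2\<close> around the points are disjoint and lie in the ball of
  radius \<open>1 + \<epsilon> / 2\<close>.\<close>

lemma card_separated_le:
  fixes S :: "'a::euclidean_space set"
  assumes S: "finite S" "S \<subseteq> cball 0 1"
    and sep: "\<And>x y. x \<in> S \<Longrightarrow> y \<in> S \<Longrightarrow> x \<noteq> y \<Longrightarrow> \<epsilon> \<le> dist x y" and e: "0 < \<epsilon>"
  shows "real (card S) \<le> (1 + 2 / \<epsilon>) ^ DIM('a)"
proof -
  let ?\<mu> = "measure lborel (ball (0 :: 'a) 1)"
  have "disjoint_family_on (\<lambda>x. ball x (\<epsilon> / 2)) S"
    unfolding disjoint_family_on_def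
  proof (intro ballI impI)
    fix x y assume "x \<in> S" "y \<in> S" "x \<noteq> y"
    then have "\<epsilon> / 2 + \<epsilon> / 2 \<le> dist x y" using sep[of x y] by simp
    then show "ball x (\<epsilon> / 2) \<inter> ball y (\<epsilon> / 2) = {}" by (rule disjoint_ballI)
  qed
  then have "measure lborel (\<Union>x\<in>S. ball x (\<epsilon> / 2)) = (\<Sum>x\<in>S. measure lborel (ball x (\<epsilon> / 2)))"
    using S(1) emeasure_lborel_ball_finite
    by (intro measure_finite_Union) (auto simp: less_top[symmetric])
  also have "\<dots> = card S * ((\<epsilon> / 2) ^ DIM('a) * ?\<mu>)"
    using e content_ball_conv_unit_ball[of "\<epsilon> / 2" "_ :: 'a"] by simp
  finally have 1: "measure lborel (\<Union>x\<in>S. ball x (\<epsilon> / 2)) = card S * ((\<epsilon> / 2) ^ DIM('a) * ?\<mu>)" .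
  have "(\<Union>x\<in>S. ball x (\<epsilon> / 2)) \<subseteq> ball 0 (1 + \<epsilon> / 2)"
  proof
    fix z assume "z \<in> (\<Union>x\<in>S. ball x (\<epsilon> / 2))"
    then obtain x where "x \<in> S" "dist x z < \<epsilon> / 2" by auto
    then show "z \<in> ball 0 (1 + \<epsilon> / 2)"
      using S(2) dist_triangle[of 0 z x] by (auto simp: subset_iff)
  qed
  then have "measure lborel (\<Union>x\<in>S. ball x (\<epsilon> / 2)) \<le> measure lborel (ball (0 :: 'a) (1 + \<epsilon> / 2))"
    by (intro measure_mono_fmeasurable)
      (auto intro!: fmeasurableI emeasure_lborel_ball_finite borel_open)
  also have "\<dots> = (1 + \<epsilon> / 2) ^ DIM('a) * ?\<mu>"
    using e by (subst content_ball_conv_unit_ball) auto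
  finally have "card S * (\<epsilon> / 2) ^ DIM('a) * ?\<mu> \<le> (1 + \<epsilon> / 2) ^ DIM('a) * ?\<mu>"
    using 1 by (simp add: mult.assoc)
  moreover have "?\<mu> > 0" by (simp add: content_ball_pos)
  ultimately have "card S * (\<epsilon> / 2) ^ DIM('a) \<le> (1 + \<epsilon> / 2) ^ DIM('a)" by simp
  then have "card S \<le> (1 + \<epsilon> / 2) ^ DIM('a) / (\<epsilon> / 2) ^ DIM('a)"
    using e by (subst pos_le_divide_eq) auto
  also have "\<dots> = ((1 + \<epsilon> / 2) / (\<epsilon> / 2)) ^ DIM('a)" by (rule power_divide[symmetric])
  also have "(1 + \<epsilon> / 2) / (\<epsilon> / 2) = 1 + 2 / \<epsilon>" using e by (simp add: field_simps)
  finally show ?thesis .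
qed

text \<open>A separated set of largest cardinality is a net, since a point far from all its elements could be
  added.\<close>

lemma unit_ball_net:
  fixes \<epsilon> :: real
  assumes e: "0 < \<epsilon>"
  obtains S :: "'a::euclidean_space set" where "finite S" "S \<subseteq> cball 0 1"
    "real (card S) \<le> (1 + 2 / \<epsilon>) ^ DIM('a)" "\<forall>x\<in>cball 0 1. \<exists>y\<in>S. dist x y < \<epsilon>"
proof -
  define P where "P S \<longleftrightarrow> finite S \<and> S \<subseteq> cball 0 1 \<and>
    (\<forall>x\<in>S. \<forall>y\<in>S. x \<noteq> y \<longrightarrow> \<epsilon> \<le> dist x y)" for S :: "'a set"
  have le: "real (card S) \<le> (1 + 2 / \<epsilon>) ^ DIM('a)" if "P S" for S
    using that e by (intro card_separated_le) (auto simp: P_def)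
  then have "card S \<le> nat \<lfloor>(1 + 2 / \<epsilon>) ^ DIM('a)\<rfloor>" if "P S" for S
    using that by (simp add: le_nat_floor)
  moreover have "P {}" by (simp add: P_def)
  ultimately have "\<exists>S. P S \<and> (\<forall>T. P T \<longrightarrow> card T \<le> card S)"
    by (intro ex_has_greatest_nat[where b = "Suc (nat \<lfloor>(1 + 2 / \<epsilon>) ^ DIM('a)\<rfloor>)"])
      (auto simp: less_Suc_eq_le)
  then obtain S where S: "P S" and max: "\<And>T. P T \<Longrightarrow> card T \<le> card S" by blast
  have "\<exists>y\<in>S. dist x y < \<epsilon>" if x: "x \<in> cball 0 1" for x
  proof (rule ccontr)
    assume far: "\<not> ?thesis"
    then have "x \<notin> S" using e by force
    have "P (insert x S)" using S x far by (auto simp: P_def dist_commute not_less)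
    then show False using max[of "insert x S"] \<open>x \<notin> S\<close> S by (simp add: P_def)
  qed
  then have "\<forall>x\<in>cball 0 1. \<exists>y\<in>S. dist x y < \<epsilon>" by blast
  moreover have "finite S" "S \<subseteq> cball 0 1" using S by (auto simp: P_def)
  ultimately show ?thesis using le[OF S] by (intro that)
qed

text \<open>A point outside the hull would be separated from it by a direction \<open>a\<close>, but the net contains a
  point so close to \<open>- sgn a\<close> that its inner product with \<open>a\<close> is at most \<open>- (1 - \<epsilon>) * norm a\<close>,
  the least value that \<open>a\<close> takes on the ball.\<close>

lemma cball_subset_convex_hull_net:
  fixes S :: "'a::euclidean_space set"
  assumes "finite S" and e: "\<epsilon> < 1" and net: "\<forall>x\<in>cball 0 1. \<exists>y\<in>S. dist x y < \<epsilon>"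
  shows "cball 0 (1 - \<epsilon>) \<subseteq> convex hull S"
proof
  fix x :: 'a assume x: "x \<in> cball 0 (1 - \<epsilon>)"
  show "x \<in> convex hull S"
  proof (rule ccontr)
    assume "x \<notin> convex hull S"
    then obtain a b where ab: "a \<bullet> x < b" "\<And>y. y \<in> convex hull S \<Longrightarrow> a \<bullet> y > b"
      using separating_hyperplane_closed_point[of "convex hull S" x] assms(1)
      by (auto simp: finite_imp_compact_convex_hull compact_imp_closed)
    have "- sgn a \<in> cball 0 1" by (simp add: norm_sgn)
    then obtain y where y: "y \<in> S" "dist (- sgn a) y < \<epsilon>" using net by blast
    have "a \<bullet> y = a \<bullet> (y + sgn a) - norm a"
      by (cases "a = 0") (simp_all add: inner_add_right sgn_div_norm power2_norm_eq_inner[symmetric]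
          power2_eq_square)
    also have "a \<bullet> (y + sgn a) \<le> norm a * norm (y + sgn a)" by (rule norm_cauchy_schwarz)
    also have "norm (y + sgn a) = dist y (- sgn a)" by (simp add: dist_norm)
    also have "norm a * dist y (- sgn a) \<le> norm a * \<epsilon>"
      using y(2) by (intro mult_left_mono) (simp_all add: dist_commute)
    also have "norm a * \<epsilon> - norm a = - (norm a * (1 - \<epsilon>))" by (simp add: algebra_simps)
    also have "\<dots> \<le> - (norm a * norm x)" using x by (simp add: mult_left_mono)
    also have "\<dots> \<le> a \<bullet> x"
      using norm_cauchy_schwarz[of "- a" x] by simp
    finally have "a \<bullet> y \<le> a \<bullet> x" by simp
    moreover have "a \<bullet> y > b" using ab(2) y(1) by (simp add: hull_inc)
    ultimately show False using ab(1) by simp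
  qed
qed

text \<open>The outer product is bilinear, so the two arguments can be expanded as convex combinations one
  after the other.\<close>

lemma outer_convex_hull:
  assumes "u \<in> convex hull S" "v \<in> convex hull T"
  shows "outer u v \<in> convex hull ((\<lambda>(a, b). outer a b) ` (S \<times> T))" (is "_ \<in> ?H")
proof -
  have b: "outer a v \<in> ?H" if "a \<in> S" for a
  proof -
    have "outer a v \<in> convex hull (outer a ` T)"
      using assms(2) convex_hull_linear_image[OF linear_outer_right, of a T] by blast
    also have "\<dots> \<subseteq> ?H" using that by (intro hull_mono) auto
    finally show ?thesis .
  qed
  have "outer u v \<in> convex hull ((\<lambda>a. outer a v) ` S)"
    using assms(1) convex_hull_linear_image[OF linear_outer_left, of v S] by blast
  also have "\<dots> \<subseteq> ?H" using b by (intro hull_minimal) auto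
  finally show ?thesis .
qed

text \<open>Products of two nets with \<open>\<epsilon> = 1 / 4\<close>: each has at most \<open>9 ^ d\<close> points in dimension \<open>d\<close>, and its hull
  contains the ball of radius \<open>3 / 4\<close>, which squares to \<open>9 / 16\<close>.\<close>

lemma finite_atoms:
  obtains S :: "(real^'p^'k) set" where "finite S" "S \<subseteq> cball 0 1"
    "card S \<le> 9 ^ (CARD('k) + CARD('p))"
    "\<forall>u v. norm u \<le> 1 \<longrightarrow> norm v \<le> 1 \<longrightarrow> (9 / 16) *\<^sub>R outer u v \<in> convex hull S"
proof -
  have e: "0 < (1 / 4 :: real)" by simp
  obtain A :: "(real^'k) set" where A: "finite A" "A \<subseteq> cball 0 1"
    "card A \<le> (1 + 2 / (1 / 4 :: real)) ^ DIM(real^'k)" "\<forall>x\<in>cball 0 1. \<exists>y\<in>A. dist x y < 1 / 4"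
    by (rule unit_ball_net[OF e])
  obtain B :: "(real^'p) set" where B: "finite B" "B \<subseteq> cball 0 1"
    "card B \<le> (1 + 2 / (1 / 4 :: real)) ^ DIM(real^'p)" "\<forall>x\<in>cball 0 1. \<exists>y\<in>B. dist x y < 1 / 4"
    by (rule unit_ball_net[OF e])
  define S where "S = (\<lambda>(a, b). outer a b) ` (A \<times> B)"
  have "real (card A) \<le> real (9 ^ CARD('k))" "real (card B) \<le> real (9 ^ CARD('p))"
    using A(3) B(3) by simp_all
  then have "card A * card B \<le> 9 ^ CARD('k) * 9 ^ CARD('p)"
    unfolding of_nat_le_iff by (rule mult_mono) simp_all
  then have "card S \<le> 9 ^ (CARD('k) + CARD('p))"
    using card_image_le[of "A \<times> B" "\<lambda>(a, b). outer a b"] A(1) B(1)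
    by (simp add: S_def power_add card_cartesian_product)
  moreover have "finite S" using A(1) B(1) by (simp add: S_def)
  moreover have "S \<subseteq> cball 0 1"
  proof -
    have "norm a * norm b \<le> 1" if "a \<in> A" "b \<in> B" for a b
    proof -
      have "norm a \<le> 1" "norm b \<le> 1" using that A(2) B(2) by auto
      then show ?thesis by (simp add: mult_le_one)
    qed
    then show ?thesis by (auto simp: S_def norm_outer)
  qed
  moreover have "(9 / 16) *\<^sub>R outer u v \<in> convex hull S" if uv: "norm u \<le> 1" "norm v \<le> 1" for u v
  proof -
    have "(3 / 4) *\<^sub>R u \<in> convex hull A" "(3 / 4) *\<^sub>R v \<in> convex hull B"
      using cball_subset_convex_hull_net[OF A(1) _ A(4)]
        cball_subset_convex_hull_net[OF B(1) _ B(4)] uv by (auto simp: subset_iff)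
    from outer_convex_hull[OF this] show ?thesis by (simp add: outer_scaleR S_def)
  qed
  ultimately show ?thesis by (intro that) auto
qed

text \<open>The rescaled direction in the hull has squared norm \<open>1 / (5 * r * (16 / 9)\<^sup>2)\<close>, and
  \<open>5 * (16 / 9)\<^sup>2\<close> is slightly below 16.\<close>

lemma descent_direction_in_hull:
  fixes \<Theta> \<Delta> :: "real^'p^'k" and S :: "(real^'p^'k) set"
  assumes le: "nuclear_norm (\<Theta> + \<Delta>) \<le> nuclear_norm \<Theta>" and "\<Delta> \<noteq> 0" and r: "rank \<Theta> \<ge> 1"
    and S: "\<forall>u v. norm u \<le> 1 \<longrightarrow> norm v \<le> 1 \<longrightarrow> (9 / 16) *\<^sub>R outer u v \<in> convex hull S"
  obtains t where "t *\<^sub>R \<Delta> \<in> convex hull S" "1 \<le> 16 * rank \<Theta> * (norm (t *\<^sub>R \<Delta>))\<^sup>2"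
proof -
  let ?C = "(*\<^sub>R) (16 / 9) ` (convex hull S)"
  have "\<exists>c\<in>?C. \<Delta> = (sqrt (5 * rank \<Theta>) * norm \<Delta>) *\<^sub>R c"
  proof (rule descent_direction_atomic[OF le])
    show "convex ?C" by (intro convex_scaling convex_convex_hull)
    show o: "outer u v \<in> ?C" if "norm u \<le> 1" "norm v \<le> 1" for u v
      using S that by (intro image_eqI[of _ _ "(9 / 16) *\<^sub>R outer u v"]) auto
    have "outer 0 0 \<in> ?C" by (rule o) auto
    then show "0 \<in> ?C" by (simp add: outer_def zero_vec_def)
  qed
  then obtain c where c: "c \<in> convex hull S" and \<Delta>: "\<Delta> = (sqrt (5 * rank \<Theta>) * norm \<Delta> * (16 / 9)) *\<^sub>R c"
    by auto
  define s where "s = sqrt (5 * rank \<Theta>) * norm \<Delta> * (16 / 9)"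
  have s: "s > 0" using r \<open>\<Delta> \<noteq> 0\<close> by (simp add: s_def)
  have "c = inverse s *\<^sub>R \<Delta>" using s \<Delta> by (metis s_def scaleR_scaleR left_inverse less_irrefl scaleR_one)
  moreover have "1 \<le> 16 * rank \<Theta> * (norm (inverse s *\<^sub>R \<Delta>))\<^sup>2"
  proof -
    have "s\<^sup>2 = 5 * rank \<Theta> * (norm \<Delta>)\<^sup>2 * (256 / 81)"
      by (simp add: s_def power_mult_distrib power_divide)
    also have "\<dots> \<le> 16 * rank \<Theta> * (norm \<Delta>)\<^sup>2" by simp
    finally show ?thesis using s by (simp add: power_mult_distrib power_inverse divide_simps)
  qed
  ultimately show ?thesis using c that by metis
qed
section \<open>Sparsification of kernel elements\<close>

text \<open>Maurey's empirical method, derandomised. Think of \<open>w\<close> as a probability distribution on \<open>S\<close> with mean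
  \<open>c\<close>. For a quadratic \<open>q\<close>, adding a random atom instead of its mean changes the expected value of \<open>q\<close> by a
  constant \<open>V\<close> that does not depend on the starting point; this is the hypothesis \<open>avg\<close>. The atoms are
  chosen one at a time so that the conditional expectation, with the remaining atoms still random,
  never increases. The start \<open>x\<close> is arbitrary because the induction shifts it by the chosen atom.\<close>

lemma maurey_list:
  fixes S :: "'a::real_inner set" and q :: "'a \<Rightarrow> real"
  assumes S: "finite S"
    and w: "\<And>s. s \<in> S \<Longrightarrow> 0 \<le> w s" "(\<Sum>s\<in>S. w s) = 1" and c: "c = (\<Sum>s\<in>S. w s *\<^sub>R s)"
    and avg: "\<And>x. (\<Sum>s\<in>S. w s * q (x + s)) = q (x + c) + V"
  shows "\<exists>l. set l \<subseteq> S \<and> length l = m \<and> q (x + sum_list l) \<le> q (x + real m *\<^sub>R c) + real m * V"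
proof (induction m arbitrary: x)
  case 0
  show ?case by simp
next
  case (Suc m)
  let ?y = "x + real m *\<^sub>R c"
  have "\<exists>s\<in>S. q (?y + s) \<le> q (?y + c) + V"
  proof (rule ccontr)
    assume "\<not> ?thesis"
    then have gt: "q (?y + c) + V < q (?y + s)" if "s \<in> S" for s using that by force
    obtain s where s: "s \<in> S" "w s > 0"
      using w by (metis less_eq_real_def sum.neutral zero_neq_one)
    have "(\<Sum>s\<in>S. w s * (q (?y + c) + V)) < (\<Sum>s\<in>S. w s * q (?y + s))"
    proof (rule sum_strict_mono_ex1[OF S])
      show "\<forall>s\<in>S. w s * (q (?y + c) + V) \<le> w s * q (?y + s)"
        using gt w(1) by (intro ballI mult_left_mono) (auto intro: less_imp_le)
      show "\<exists>s\<in>S. w s * (q (?y + c) + V) < w s * q (?y + s)"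
        using s gt by (intro bexI[of _ s]) auto
    qed
    then show False using avg[of ?y] w(2) by (simp flip: sum_distrib_right)
  qed
  then obtain s where s: "s \<in> S" "q (?y + s) \<le> q (?y + c) + V" by blast
  obtain l where l: "set l \<subseteq> S" "length l = m"
    "q ((x + s) + sum_list l) \<le> q ((x + s) + real m *\<^sub>R c) + real m * V"
    using Suc.IH[of "x + s"] by blast
  have "q (x + sum_list (s # l)) \<le> q (x + real (Suc m) *\<^sub>R c) + real (Suc m) * V"
    using l(3) s(2) by (simp add: algebra_simps)
  then show ?case using s(1) l by (intro exI[of _ "s # l"]) auto
qed

text \<open>Apply the preceding lemma to the quadratic form \<open>q x = \<Sum>(X i \<bullet> x)\<^sup>2 - N / 4 * (norm x)\<^sup>2\<close>, whose value at
  \<open>t *\<^sub>R c\<close> is \<open>- N / 4 * t\<^sup>2 * (norm c)\<^sup>2\<close> because \<open>c\<close> is in the kernel. At \<open>t = m\<close> this decreases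
  quadratically in \<open>m\<close>, whereas the sampling error \<open>m * V\<close> is linear in \<open>m\<close> as the squared measurements of
  each atom are bounded. So a sum of enough atoms has measurements that are far too
  small for its norm, like \<open>c\<close> itself; unlike \<open>c\<close>, it ranges over a finite set.\<close>

lemma kernel_in_hull_gives_short_sum:
  fixes S :: "'a::euclidean_space set" and X :: "nat \<Rightarrow> 'a"
  assumes S: "finite S" and hull: "c \<in> convex hull S"
    and ker: "\<And>i. i \<in> I \<Longrightarrow> X i \<bullet> c = 0"
    and N: "N > 0"
    and upper: "\<And>s. s \<in> S \<Longrightarrow> (\<Sum>i\<in>I. (X i \<bullet> s)\<^sup>2) \<le> 2 * N"
    and m: "8 < (real m - 1) * (norm c)\<^sup>2"
  shows "\<exists>l. set l \<subseteq> S \<and> length l = m \<and>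
    (\<Sum>i\<in>I. (X i \<bullet> sum_list l)\<^sup>2) < N / 4 * (norm (sum_list l))\<^sup>2"
proof -
  define q where "q x = (\<Sum>i\<in>I. (X i \<bullet> x)\<^sup>2) - N / 4 * (norm x)\<^sup>2" for x
  obtain w where w: "\<And>s. s \<in> S \<Longrightarrow> 0 \<le> w s" "(\<Sum>s\<in>S. w s) = 1" "c = (\<Sum>s\<in>S. w s *\<^sub>R s)"
    using hull unfolding convex_hull_finite[OF S] by blast
  define b where "b x y = (\<Sum>i\<in>I. (X i \<bullet> x) * (X i \<bullet> y)) - N / 4 * (x \<bullet> y)" for x y
  have q_add: "q (x + y) = q x + 2 * b x y + q y" for x y
    unfolding q_def b_def power2_norm_eq_inner
    by (simp add: inner_add_left inner_add_right inner_commute[of y x]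
        power2_eq_square algebra_simps sum.distrib sum_distrib_left)
  have b_sum: "b x c = (\<Sum>s\<in>S. w s * b x s)" for x
  proof -
    have "(\<Sum>i\<in>I. (X i \<bullet> x) * (X i \<bullet> c)) = (\<Sum>s\<in>S. w s * (\<Sum>i\<in>I. (X i \<bullet> x) * (X i \<bullet> s)))"
      unfolding w(3) inner_sum_right sum_distrib_left
      by (subst sum.swap) (simp add: mult.left_commute)
    moreover have "x \<bullet> c = (\<Sum>s\<in>S. w s * (x \<bullet> s))" unfolding w(3) inner_sum_right by simp
    ultimately show ?thesis
      by (simp add: b_def right_diff_distrib sum_subtractf sum_distrib_left mult.left_commute)
  qed
  define V where "V = (\<Sum>s\<in>S. w s * q s) - q c"
  have avg: "(\<Sum>s\<in>S. w s * q (x + s)) = q (x + c) + V" for x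
  proof -
    have "(\<Sum>s\<in>S. w s * q (x + s)) = (\<Sum>s\<in>S. w s) * q x + 2 * (\<Sum>s\<in>S. w s * b x s) + (\<Sum>s\<in>S. w s * q s)"
      unfolding q_add
      by (simp add: distrib_left sum.distrib sum_distrib_left sum_distrib_right mult.left_commute)
    then show ?thesis by (simp add: w(2) V_def q_add b_sum)
  qed
  obtain l where l: "set l \<subseteq> S" "length l = m" "q (0 + sum_list l) \<le> q (0 + real m *\<^sub>R c) + real m * V"
    using maurey_list[OF S w avg, of m 0] by blast
  have qc: "q (t *\<^sub>R c) = - (N / 4 * t\<^sup>2 * (norm c)\<^sup>2)" for t
    using ker by (simp add: q_def power_mult_distrib)
  have "(\<Sum>s\<in>S. w s * q s) \<le> (\<Sum>s\<in>S. w s * (2 * N))"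
  proof (intro sum_mono mult_left_mono w)
    fix s assume "s \<in> S"
    have "0 \<le> N / 4 * (norm s)\<^sup>2" using N by simp
    then show "q s \<le> 2 * N" using upper[OF \<open>s \<in> S\<close>] by (simp add: q_def)
  qed
  then have "V \<le> 2 * N + N / 4 * (norm c)\<^sup>2"
    using qc[of 1] w(2) by (simp add: V_def flip: sum_distrib_right)
  then have "real m * V \<le> real m * (2 * N + N / 4 * (norm c)\<^sup>2)" by (intro mult_left_mono) auto
  then have "q (sum_list l) \<le> - (N / 4 * (real m)\<^sup>2 * (norm c)\<^sup>2) + real m * (2 * N + N / 4 * (norm c)\<^sup>2)"
    using l(3) qc[of "real m"] by simp
  also have "\<dots> = - (N / 4 * real m * ((real m - 1) * (norm c)\<^sup>2 - 8))"
    by (simp add: power2_eq_square algebra_simps)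
  also have "\<dots> < 0"
  proof -
    have "m > 0"
    proof (rule ccontr)
      assume "\<not> m > 0"
      then have "8 < - (norm c)\<^sup>2" using m by simp
      then show False using zero_le_power2[of "norm c"] by linarith
    qed
    then show ?thesis using m N by simp
  qed
  finally show ?thesis using l by (auto simp: q_def)
qed
section \<open>Gaussian measurements of a fixed matrix\<close>

lemma trace_transpose_mult: "trace (transpose X ** (\<Theta> :: real^'p^'k)) = X \<bullet> \<Theta>"
proof -
  have "trace (transpose X ** \<Theta>) = (\<Sum>j\<in>UNIV. \<Sum>i\<in>UNIV. X $ i $ j * \<Theta> $ i $ j)"
    by (simp add: trace_def matrix_matrix_mult_def transpose_def)
  also have "\<dots> = X \<bullet> \<Theta>" by (subst sum.swap) (simp add: inner_vec_def)
  finally show ?thesis .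
qed

context prob_space
begin

text \<open>A sum of independent centred normal variables is normal, with variance the sum of the variances,
  here \<open>(norm Z)\<^sup>2\<close>. Entries where \<open>Z\<close> vanishes are left out of the sum, since a normal density requires a
  positive standard deviation.\<close>

lemma gaussian_matrix_inner_distributed:
  fixes Y :: "'a \<Rightarrow> real^'p^'k" and Z :: "real^'p^'k"
  assumes indep: "indep_vars (\<lambda>_. borel) (\<lambda>(a, b) \<omega>. Y \<omega> $ a $ b) (UNIV :: ('k \<times> 'p) set)"
    and normal: "\<And>a b. distributed M lborel (\<lambda>\<omega>. Y \<omega> $ a $ b) std_normal_density"
    and Z: "norm Z = 1"
  shows "distributed M lborel (\<lambda>\<omega>. Y \<omega> \<bullet> Z) std_normal_density"
proof -
  define z where "z = (\<lambda>(a, b). Z $ a $ b)"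
  define I where "I = {i :: 'k \<times> 'p. z i \<noteq> 0}"
  define W where "W i \<omega> = z i * (case i of (a, b) \<Rightarrow> Y \<omega> $ a $ b)" for i \<omega>
  have inner: "A \<bullet> Z = (\<Sum>i\<in>UNIV. z i * (case i of (a, b) \<Rightarrow> A $ a $ b))" for A :: "real^'p^'k"
    unfolding inner_vec_def z_def
    by (simp add: sum.cartesian_product UNIV_Times_UNIV[symmetric] mult.commute case_prod_unfold
        del: UNIV_Times_UNIV)
  have "(\<Sum>i\<in>I. \<bar>z i\<bar>\<^sup>2) = (\<Sum>i\<in>UNIV. (z i)\<^sup>2)"
    by (simp add: I_def) (rule sum.mono_neutral_left, auto)
  also have "\<dots> = 1"
    using inner[of Z] Z by (simp add: z_def power2_eq_square case_prod_unfold norm_eq_1)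
  finally have var: "(\<Sum>i\<in>I. \<bar>z i\<bar>\<^sup>2) = 1" .
  have "distributed M lborel (\<lambda>\<omega>. \<Sum>i\<in>I. W i \<omega>) (normal_density (\<Sum>i\<in>I. 0) (sqrt (\<Sum>i\<in>I. \<bar>z i\<bar>\<^sup>2)))"
  proof (rule sum_indep_normal)
    show "I \<noteq> {}" using var by force
    have "indep_vars (\<lambda>_. borel) (\<lambda>(a, b) \<omega>. Y \<omega> $ a $ b) I"
      by (rule indep_vars_subset[OF indep]) simp
    then have "indep_vars (\<lambda>_. borel) (\<lambda>i \<omega>. z i * (case_prod (\<lambda>a b \<omega>. Y \<omega> $ a $ b) i \<omega>)) I"
      by (rule indep_vars_compose2) simp
    also have "(\<lambda>i \<omega>. z i * (case_prod (\<lambda>a b \<omega>. Y \<omega> $ a $ b) i \<omega>)) = W"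
      by (auto simp: W_def fun_eq_iff split: prod.split)
    finally show "indep_vars (\<lambda>i. borel) W I" .
    show "0 < \<bar>z i\<bar>" if "i \<in> I" for i using that by (simp add: I_def)
    show "distributed M lborel (W i) (normal_density 0 \<bar>z i\<bar>)" if "i \<in> I" for i
    proof -
      obtain a b where i: "i = (a, b)" by (cases i)
      have "distributed M lborel (\<lambda>\<omega>. 0 + z i * Y \<omega> $ a $ b) (normal_density (0 + z i * 0) (\<bar>z i\<bar> * 1))"
        using that by (intro normal_density_affine normal) (auto simp: I_def)
      then show ?thesis by (simp add: W_def[abs_def] i)
    qed
  qed simp
  moreover have "(\<Sum>i\<in>I. W i \<omega>) = Y \<omega> \<bullet> Z" for \<omega>
    unfolding inner W_def by (rule sum.mono_neutral_left) (auto simp: I_def)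
  ultimately show ?thesis unfolding var by simp
qed

text \<open>The exponent is parametrised so that the exponential times the standard normal density is
  \<open>\<sigma>\<close> times the centred normal density of standard deviation \<open>\<sigma>\<close>.\<close>

lemma nn_integral_exp_square_std_normal:
  assumes Y: "distributed M lborel Y std_normal_density" and \<sigma>: "\<sigma> > 0"
  shows "(\<integral>\<^sup>+\<omega>. ennreal (exp ((1 - 1 / \<sigma>\<^sup>2) / 2 * (Y \<omega>)\<^sup>2)) \<partial>M) = ennreal \<sigma>"
proof -
  have "(\<integral>\<^sup>+\<omega>. ennreal (exp ((1 - 1 / \<sigma>\<^sup>2) / 2 * (Y \<omega>)\<^sup>2)) \<partial>M)
      = (\<integral>\<^sup>+x. ennreal (std_normal_density x) * ennreal (exp ((1 - 1 / \<sigma>\<^sup>2) / 2 * x\<^sup>2)) \<partial>lborel)"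
    by (rule distributed_nn_integral[OF Y, symmetric]) simp
  also have "\<dots> = (\<integral>\<^sup>+x. ennreal \<sigma> * ennreal (normal_density 0 \<sigma> x) \<partial>lborel)"
  proof (intro nn_integral_cong)
    fix x :: real
    have "exp (- x\<^sup>2 / 2) * exp ((1 - 1 / \<sigma>\<^sup>2) / 2 * x\<^sup>2) = exp (- x\<^sup>2 / (2 * \<sigma>\<^sup>2))"
      unfolding exp_add[symmetric] using \<sigma> by (simp add: field_simps)
    then have "std_normal_density x * exp ((1 - 1 / \<sigma>\<^sup>2) / 2 * x\<^sup>2) = \<sigma> * normal_density 0 \<sigma> x"
      using \<sigma> by (simp add: normal_density_def real_sqrt_mult)
    then show "ennreal (std_normal_density x) * ennreal (exp ((1 - 1 / \<sigma>\<^sup>2) / 2 * x\<^sup>2))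
        = ennreal \<sigma> * ennreal (normal_density 0 \<sigma> x)"
      using \<sigma> by (simp flip: ennreal_mult')
  qed
  also have "\<dots> = ennreal \<sigma> * (\<integral>\<^sup>+x. ennreal (normal_density 0 \<sigma> x) \<partial>lborel)"
    by (rule nn_integral_cmult) simp
  also have "(\<integral>\<^sup>+x. ennreal (normal_density 0 \<sigma> x) \<partial>lborel) = 1"
    using prob_space.emeasure_space_1[OF prob_space_normal_density[OF \<sigma>, of 0]]
    by (simp add: emeasure_density)
  finally show ?thesis by simp
qed

text \<open>Chernoff's bound for the chi-squared distribution. The factor \<open>(1 - 1 / \<sigma>\<^sup>2) / 2\<close> is positive for
  \<open>\<sigma> > 1\<close> and negative for \<open>\<sigma> < 1\<close>, so the inequality in this form covers the upper and the lower
  tail at once.\<close>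

lemma sum_squares_std_normal_tail:
  fixes Y :: "nat \<Rightarrow> 'a \<Rightarrow> real"
  assumes indep: "indep_vars (\<lambda>_. borel) Y {1..N}"
    and normal: "\<And>i. i \<in> {1..N} \<Longrightarrow> distributed M lborel (Y i) std_normal_density"
    and \<sigma>: "\<sigma> > 0"
  shows "prob {\<omega> \<in> space M. (1 - 1 / \<sigma>\<^sup>2) / 2 * (\<Sum>i=1..N. (Y i \<omega>)\<^sup>2) \<ge> (1 - 1 / \<sigma>\<^sup>2) / 2 * a}
    \<le> exp (- ((1 - 1 / \<sigma>\<^sup>2) / 2 * a)) * \<sigma> ^ N"
proof -
  define s where "s = (1 - 1 / \<sigma>\<^sup>2) / 2"
  have Ym[measurable]: "Y i \<in> borel_measurable M" if "i \<in> {1..N}" for i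
    using indep that unfolding indep_vars_def by auto
  define f where "f \<omega> = (\<Sum>i=1..N. (Y i \<omega>)\<^sup>2)" for \<omega>
  have fm[measurable]: "f \<in> borel_measurable M"
    unfolding f_def using Ym by (intro borel_measurable_sum) auto
  have "indep_vars (\<lambda>_. borel) (\<lambda>i \<omega>. ennreal (exp (s * (Y i \<omega>)\<^sup>2))) {1..N}"
    by (rule indep_vars_compose2[OF indep]) simp
  then have "(\<integral>\<^sup>+\<omega>. (\<Prod>i=1..N. ennreal (exp (s * (Y i \<omega>)\<^sup>2))) \<partial>M)
      = (\<Prod>i=1..N. \<integral>\<^sup>+\<omega>. ennreal (exp (s * (Y i \<omega>)\<^sup>2)) \<partial>M)"
    by (intro indep_vars_nn_integral) auto
  also have "\<dots> = (\<Prod>i=1..N. ennreal \<sigma>)"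
    unfolding s_def using normal \<sigma> by (intro prod.cong nn_integral_exp_square_std_normal) auto
  finally have mgf: "(\<integral>\<^sup>+\<omega>. ennreal (exp (s * f \<omega>)) \<partial>M) = ennreal (\<sigma> ^ N)"
    using \<sigma> by (simp add: f_def sum_distrib_left exp_sum prod_ennreal ennreal_power)
  have "emeasure M {\<omega> \<in> space M. s * f \<omega> \<ge> s * a}
      \<le> emeasure M {\<omega> \<in> space M. 1 \<le> ennreal (exp (- (s * a))) * ennreal (exp (s * f \<omega>))}"
  proof (rule emeasure_mono)
    show "{\<omega> \<in> space M. s * f \<omega> \<ge> s * a}
      \<subseteq> {\<omega> \<in> space M. 1 \<le> ennreal (exp (- (s * a))) * ennreal (exp (s * f \<omega>))}"
      by (auto simp: ennreal_mult'[symmetric] exp_add[symmetric] ennreal_ge_1)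
  qed measurable
  also have "\<dots> \<le> ennreal (exp (- (s * a))) *
      (\<integral>\<^sup>+\<omega>. ennreal (exp (s * f \<omega>)) * indicator (space M) \<omega> \<partial>M)"
    by (intro nn_integral_Markov_inequality) auto
  also have "(\<integral>\<^sup>+\<omega>. ennreal (exp (s * f \<omega>)) * indicator (space M) \<omega> \<partial>M) = ennreal (\<sigma> ^ N)"
    unfolding mgf[symmetric] by (intro nn_integral_cong) simp
  finally show ?thesis
    using \<sigma> by (simp add: emeasure_eq_measure f_def s_def flip: ennreal_mult')
qed

end
section \<open>Measurability of the event of failed recovery\<close>

text \<open>By duality, the sublevel set is an intersection of half-spaces.\<close>

lemma closed_nuclear_norm_sublevel: "closed {A :: real^'p^'k. nuclear_norm A \<le> t}"
proof -
  have "{A :: real^'p^'k. nuclear_norm A \<le> t}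
    = (\<Inter>W\<in>{W. \<forall>x. norm (W *v x) \<le> norm x}. {A. W \<bullet> A \<le> t})"
  proof (intro set_eqI iffI)
    fix A :: "real^'p^'k" assume "A \<in> {A. nuclear_norm A \<le> t}"
    then show "A \<in> (\<Inter>W\<in>{W. \<forall>x. norm (W *v x) \<le> norm x}. {A. W \<bullet> A \<le> t})"
      using inner_le_nuclear_norm order_trans by fastforce
  next
    fix A :: "real^'p^'k" assume A: "A \<in> (\<Inter>W\<in>{W. \<forall>x. norm (W *v x) \<le> norm x}. {A. W \<bullet> A \<le> t})"
    obtain W where W: "\<forall>x. norm (W *v x) \<le> norm x" "W \<bullet> A = nuclear_norm A"
      using polar_factor[of A] by metis
    then have "W \<bullet> A \<le> t" using A by blast
    then show "A \<in> {A. nuclear_norm A \<le> t}" using W(2) by simp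
  qed
  moreover have "closed (\<Inter>W\<in>{W :: real^'p^'k. \<forall>x. norm (W *v x) \<le> norm x}. {A. W \<bullet> A \<le> t})"
    by (intro closed_INT ballI closed_halfspace_le)
  ultimately show ?thesis by simp
qed

text \<open>Compactness turns the uncountable quantifier into a countable one: a continuous nonnegative function
  vanishes somewhere on \<open>K\<close> exactly when it takes arbitrarily small values on a countable dense subset.\<close>

lemma kernel_meets_compact_measurable:
  fixes K :: "'b::euclidean_space set"
  assumes K: "compact K" and I: "finite I"
    and X[measurable]: "\<And>i. i \<in> I \<Longrightarrow> X i \<in> borel_measurable M"
  shows "{\<omega> \<in> space M. \<exists>x\<in>K. \<forall>i\<in>I. X i \<omega> \<bullet> x = 0} \<in> sets M"
proof -
  obtain D where D: "countable D" "D \<subseteq> K" "K \<subseteq> closure D" by (rule separable)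
  define g where "g \<omega> x = (\<Sum>i\<in>I. (X i \<omega> \<bullet> x)\<^sup>2)" for \<omega> x
  have g0: "g \<omega> x = 0 \<longleftrightarrow> (\<forall>i\<in>I. X i \<omega> \<bullet> x = 0)" for \<omega> x
    using I by (simp add: g_def sum_nonneg_eq_0_iff)
  have cont: "continuous_on A (g \<omega>)" for \<omega> A
    unfolding g_def by (intro continuous_intros)
  have "(\<exists>x\<in>K. g \<omega> x = 0) \<longleftrightarrow> (\<forall>n. \<exists>d\<in>D. g \<omega> d < 1 / real (Suc n))" for \<omega>
  proof
    assume "\<exists>x\<in>K. g \<omega> x = 0"
    then obtain x where x: "x \<in> K" "g \<omega> x = 0" by blast
    show "\<forall>n. \<exists>d\<in>D. g \<omega> d < 1 / real (Suc n)"
    proof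
      fix n
      have "open ((g \<omega>) -` {..< 1 / real (Suc n)})"
        using cont by (intro open_vimage) auto
      moreover have "x \<in> (g \<omega>) -` {..< 1 / real (Suc n)}" using x by simp
      ultimately have "(g \<omega>) -` {..< 1 / real (Suc n)} \<inter> D \<noteq> {}"
        using x D(3) open_Int_closure_eq_empty by blast
      then show "\<exists>d\<in>D. g \<omega> d < 1 / real (Suc n)" by auto
    qed
  next
    assume small: "\<forall>n. \<exists>d\<in>D. g \<omega> d < 1 / real (Suc n)"
    then have "K \<noteq> {}" using D(2) by blast
    then obtain x where x: "x \<in> K" "\<And>y. y \<in> K \<Longrightarrow> g \<omega> x \<le> g \<omega> y"
      using continuous_attains_inf[OF K _ cont] by blast
    have "g \<omega> x < 1 / real (Suc n)" for n
      using small x(2) D(2) by (meson order_le_less_trans subsetD)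
    then have "g \<omega> x \<le> 0"
      by (metis nat_approx_posE not_le order_less_asym)
    moreover have "g \<omega> x \<ge> 0" by (simp add: g_def sum_nonneg)
    ultimately show "\<exists>x\<in>K. g \<omega> x = 0" using x(1) by (intro bexI[of _ x]) auto
  qed
  then have "{\<omega> \<in> space M. \<exists>x\<in>K. \<forall>i\<in>I. X i \<omega> \<bullet> x = 0}
    = {\<omega> \<in> space M. \<forall>n. \<exists>d\<in>D. g \<omega> d < 1 / real (Suc n)}"
    by (simp add: g0)
  moreover have gm[measurable]: "(\<lambda>\<omega>. g \<omega> d) \<in> borel_measurable M" for d
    unfolding g_def by (intro borel_measurable_sum borel_measurable_power borel_measurable_inner) auto
  have "{\<omega> \<in> space M. \<forall>n. \<exists>d\<in>D. g \<omega> d < 1 / real (Suc n)} \<in> sets M"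
    using D(1) by measurable
  ultimately show ?thesis by simp
qed

text \<open>The nonzero descent directions form a countable union of compact sets, obtained by intersecting the
  closed sublevel set with annuli.\<close>

lemma recovery_failure_measurable:
  fixes \<Theta> :: "real^'p^'k"
  assumes I: "finite I" and X: "\<And>i. i \<in> I \<Longrightarrow> X i \<in> borel_measurable M"
  shows "{\<omega> \<in> space M. \<exists>\<Delta>. \<Delta> \<noteq> 0 \<and> nuclear_norm (\<Theta> + \<Delta>) \<le> nuclear_norm \<Theta> \<and>
    (\<forall>i\<in>I. X i \<omega> \<bullet> \<Delta> = 0)} \<in> sets M" (is "?E \<in> _")
proof -
  define K where "K n = {\<Delta>. nuclear_norm (\<Theta> + \<Delta>) \<le> nuclear_norm \<Theta>} \<inter>
    (cball 0 (real (Suc n)) - ball 0 (1 / real (Suc n)))" for n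
  have "closed ((\<lambda>\<Delta>. \<Theta> + \<Delta>) -` {A. nuclear_norm A \<le> nuclear_norm \<Theta>})"
    by (intro closed_vimage closed_nuclear_norm_sublevel continuous_intros)
  then have "compact (K n)" for n
    unfolding K_def by (intro closed_Int_compact compact_diff) (auto simp: vimage_def)
  then have "(\<Union>n. {\<omega> \<in> space M. \<exists>\<Delta>\<in>K n. \<forall>i\<in>I. X i \<omega> \<bullet> \<Delta> = 0}) \<in> sets M"
    using kernel_meets_compact_measurable[OF _ I X] by (intro sets.countable_UN) auto
  also have "(\<Union>n. {\<omega> \<in> space M. \<exists>\<Delta>\<in>K n. \<forall>i\<in>I. X i \<omega> \<bullet> \<Delta> = 0}) = ?E"
  proof (intro equalityI subsetI)
    fix \<omega> assume "\<omega> \<in> ?E"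
    then obtain \<Delta> where \<Delta>: "\<omega> \<in> space M" "\<Delta> \<noteq> 0" "nuclear_norm (\<Theta> + \<Delta>) \<le> nuclear_norm \<Theta>"
      "\<forall>i\<in>I. X i \<omega> \<bullet> \<Delta> = 0" by blast
    obtain n1 where n1: "1 / real (Suc n1) < norm \<Delta>"
      using \<Delta>(2) nat_approx_posE[of "norm \<Delta>"] by auto
    obtain n2 where n2: "norm \<Delta> \<le> real n2" using real_arch_simple by blast
    have "1 / real (Suc (max n1 n2)) \<le> 1 / real (Suc n1)" by (intro divide_left_mono) auto
    then have "\<Delta> \<in> K (max n1 n2)" using \<Delta>(3) n1 n2 by (auto simp: K_def not_less)
    then show "\<omega> \<in> (\<Union>n. {\<omega> \<in> space M. \<exists>\<Delta>\<in>K n. \<forall>i\<in>I. X i \<omega> \<bullet> \<Delta> = 0})" using \<Delta> by blast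
  next
    fix \<omega> assume "\<omega> \<in> (\<Union>n. {\<omega> \<in> space M. \<exists>\<Delta>\<in>K n. \<forall>i\<in>I. X i \<omega> \<bullet> \<Delta> = 0})"
    moreover have "\<Delta> \<noteq> 0 \<and> nuclear_norm (\<Theta> + \<Delta>) \<le> nuclear_norm \<Theta>" if "\<Delta> \<in> K n" for \<Delta> n
      using that by (auto simp: K_def)
    ultimately show "\<omega> \<in> ?E" by blast
  qed
  finally show ?thesis .
qed

section \<open>Exact recovery\<close>

lemma is_arg_min_singleton_iff:
  fixes f :: "'b \<Rightarrow> real"
  shows "{x. is_arg_min f P x} = {a} \<longleftrightarrow> P a \<and> \<not> (\<exists>x. P x \<and> x \<noteq> a \<and> f x \<le> f a)"
proof
  assume *: "{x. is_arg_min f P x} = {a}"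
  then have a: "is_arg_min f P a" by blast
  have "x = a" if "P x" "f x \<le> f a" for x
  proof -
    have "is_arg_min f P x" using a that unfolding is_arg_min_def by force
    then show ?thesis using * by blast
  qed
  then show "P a \<and> \<not> (\<exists>x. P x \<and> x \<noteq> a \<and> f x \<le> f a)"
    using a by (auto simp: is_arg_min_def)
next
  assume *: "P a \<and> \<not> (\<exists>x. P x \<and> x \<noteq> a \<and> f x \<le> f a)"
  then show "{x. is_arg_min f P x} = {a}"
    unfolding is_arg_min_def by (auto intro: less_imp_le) (metis linear order_less_le)
qed

text \<open>The exponents are compared using only \<open>9 \<le> 2 ^ 4\<close> and \<open>ln 2 \<le> 25 / 36\<close>.\<close>

lemma upper_union_bound_small:
  assumes "real N > 1600 * real n"
  shows "9 ^ n * (exp (- (real N / 2)) * sqrt 2 ^ N) \<le> exp (- real N / 32)"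
proof -
  have l: "ln 2 \<le> (25 / 36 :: real)" by (rule ln2_le_25_over_36)
  have "(9 :: real) ^ n \<le> (2 ^ 4) ^ n" by (intro power_mono) auto
  also have "\<dots> = exp (real (4 * n) * ln 2)"
    unfolding exp_of_nat_mult by (simp add: power_mult)
  also have "\<dots> = exp (4 * real n * ln 2)" by simp
  finally have 1: "(9 :: real) ^ n \<le> exp (4 * real n * ln 2)" .
  have 2: "sqrt 2 ^ N = exp (real N * (ln 2 / 2))"
    unfolding exp_of_nat_mult by (simp flip: ln_sqrt)
  have "4 * real n * ln 2 + real N * (ln 2 / 2) \<le> (4 * real N / 1600 + real N / 2) * ln 2"
    using assms by (simp add: distrib_right mult_right_mono)
  also have "\<dots> \<le> (4 * real N / 1600 + real N / 2) * (25 / 36)"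
    using l by (intro mult_left_mono) auto
  finally have "4 * real n * ln 2 + (- (real N / 2) + real N * (ln 2 / 2)) \<le> - real N / 32" by simp
  then have *: "exp (4 * real n * ln 2) * (exp (- (real N / 2)) * exp (real N * (ln 2 / 2))) \<le> exp (- real N / 32)"
    by (simp flip: exp_add)
  have "9 ^ n * (exp (- (real N / 2)) * sqrt 2 ^ N) \<le> exp (4 * real n * ln 2) * (exp (- (real N / 2)) * sqrt 2 ^ N)"
    by (intro mult_right_mono 1) auto
  with * show ?thesis unfolding 2 by (rule order_trans[rotated])
qed

text \<open>Here \<open>9 \<le> 2 ^ 4\<close> gives at most \<open>2 ^ (520 * r * n)\<close> matrices, whose exponent is below
  \<open>520 / 1600 * N\<close>; the bound \<open>2 / 3 \<le> ln 2\<close> makes the factor \<open>2 ^ N\<close> in the denominator win.\<close>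

lemma lower_union_bound_small:
  assumes "real N > 1600 * real r * real n"
  shows "(9 ^ n) ^ (130 * r) * (exp (3 / 8 * real N) * (1 / 2) ^ N) \<le> exp (- real N / 32)"
proof -
  have l: "2 / 3 \<le> ln (2 :: real)" by (rule ln2_ge_two_thirds)
  have "((9 :: real) ^ n) ^ (130 * r) \<le> ((2 ^ 4) ^ n) ^ (130 * r)" by (intro power_mono) auto
  also have "\<dots> = exp (520 * real r * real n * ln 2)"
  proof -
    have "((2 ^ 4) ^ n) ^ (130 * r) = (2 :: real) ^ (520 * r * n)"
      unfolding power_mult[symmetric] by (simp add: ac_simps)
    also have "\<dots> = exp (real (520 * r * n) * ln 2)" unfolding exp_of_nat_mult by simp
    finally show ?thesis by simp
  qed
  finally have 1: "((9 :: real) ^ n) ^ (130 * r) \<le> exp (520 * real r * real n * ln 2)" .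
  have 2: "(1 / 2) ^ N = exp (- (real N * ln 2))"
    unfolding exp_minus exp_of_nat_mult by (simp add: power_one_over inverse_eq_divide)
  have "520 * real r * real n * ln 2 - real N * ln 2 \<le> - (1080 / 1600 * real N) * ln 2"
  proof -
    have "(520 * real r * real n) * ln 2 \<le> (520 / 1600 * real N) * ln 2"
    proof (rule mult_right_mono)
      show "520 * real r * real n \<le> 520 / 1600 * real N" using assms by linarith
    qed simp
    then show ?thesis by (simp add: algebra_simps)
  qed
  also have "\<dots> \<le> - (1080 / 1600 * real N) * (2 / 3)" using l by (intro mult_left_mono_neg) auto
  finally have "520 * real r * real n * ln 2 + (3 / 8 * real N + - (real N * ln 2)) \<le> - real N / 32"
    by simp
  then have *: "exp (520 * real r * real n * ln 2) * (exp (3 / 8 * real N) * exp (- (real N * ln 2))) \<le> exp (- real N / 32)"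
    by (simp flip: exp_add)
  have "(9 ^ n) ^ (130 * r) * (exp (3 / 8 * real N) * (1 / 2) ^ N)
      \<le> exp (520 * real r * real n * ln 2) * (exp (3 / 8 * real N) * (1 / 2) ^ N)"
    by (intro mult_right_mono 1) auto
  with * show ?thesis unfolding 2 by (rule order_trans[rotated])
qed
text \<open>The tail bound with \<open>\<sigma> = sqrt 2\<close> at level \<open>2 * N\<close> and with \<open>\<sigma> = 1 / 2\<close> at level \<open>N / 4\<close>; in
  both cases \<open>\<sigma>\<close> is the optimal choice, the square root of the level divided by \<open>N\<close>.
  As the inequalities are strict, both events are empty for \<open>Z = 0\<close>.\<close>

lemma (in prob_space) gaussian_measurements_tail:
  fixes X :: "nat \<Rightarrow> 'a \<Rightarrow> real^'p^'k" and Z :: "real^'p^'k"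
  assumes indep: "indep_vars (\<lambda>_. borel) X {1..N}"
    and entries: "\<And>i. i \<in> {1..N} \<Longrightarrow>
           indep_vars (\<lambda>_. borel) (\<lambda>(a, b) \<omega>. X i \<omega> $ a $ b) (UNIV :: ('k \<times> 'p) set)"
    and normal: "\<And>i a b. i \<in> {1..N} \<Longrightarrow> distributed M lborel (\<lambda>\<omega>. X i \<omega> $ a $ b) std_normal_density"
  shows "norm Z \<le> 1 \<Longrightarrow> prob {\<omega> \<in> space M. 2 * real N < (\<Sum>i=1..N. (X i \<omega> \<bullet> Z)\<^sup>2)}
      \<le> exp (- (real N / 2)) * sqrt 2 ^ N"
    and "prob {\<omega> \<in> space M. (\<Sum>i=1..N. (X i \<omega> \<bullet> Z)\<^sup>2) < real N / 4 * (norm Z)\<^sup>2}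
      \<le> exp (3 / 8 * real N) * (1 / 2) ^ N"
proof -
  define Y where "Y i \<omega> = X i \<omega> \<bullet> sgn Z" for i \<omega>
  have XY: "(\<Sum>i=1..N. (X i \<omega> \<bullet> Z)\<^sup>2) = (norm Z)\<^sup>2 * (\<Sum>i=1..N. (Y i \<omega>)\<^sup>2)" for \<omega>
  proof -
    have "X i \<omega> \<bullet> Z = norm Z * Y i \<omega>" for i
      by (cases "Z = 0") (simp_all add: Y_def sgn_div_norm)
    then show ?thesis by (simp add: power_mult_distrib sum_distrib_left)
  qed
  have Yi: "indep_vars (\<lambda>_. borel) Y {1..N}"
    unfolding Y_def by (rule indep_vars_compose2[OF indep]) simp
  have Yn: "distributed M lborel (Y i) std_normal_density" if "i \<in> {1..N}" "Z \<noteq> 0" for i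
    unfolding Y_def using that
    by (intro gaussian_matrix_inner_distributed entries normal) (auto simp: norm_sgn)
  have [measurable]: "(\<lambda>\<omega>. \<Sum>i=1..N. (Y i \<omega>)\<^sup>2) \<in> borel_measurable M"
    using Yi unfolding indep_vars_def by (intro borel_measurable_sum borel_measurable_power) auto
  show "prob {\<omega> \<in> space M. 2 * real N < (\<Sum>i=1..N. (X i \<omega> \<bullet> Z)\<^sup>2)}
      \<le> exp (- (real N / 2)) * sqrt 2 ^ N" if "norm Z \<le> 1"
  proof (cases "Z = 0")
    case False
    have "prob {\<omega> \<in> space M. 2 * real N < (\<Sum>i=1..N. (X i \<omega> \<bullet> Z)\<^sup>2)}
        \<le> prob {\<omega> \<in> space M. 1 / 4 * (\<Sum>i=1..N. (Y i \<omega>)\<^sup>2) \<ge> 1 / 4 * (2 * real N)}"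
    proof (rule finite_measure_mono)
      have le: "(\<Sum>i=1..N. (X i \<omega> \<bullet> Z)\<^sup>2) \<le> (\<Sum>i=1..N. (Y i \<omega>)\<^sup>2)" for \<omega>
        unfolding XY using that by (intro mult_left_le_one_le) (auto simp: sum_nonneg power_le_one)
      show "{\<omega> \<in> space M. 2 * real N < (\<Sum>i=1..N. (X i \<omega> \<bullet> Z)\<^sup>2)}
        \<subseteq> {\<omega> \<in> space M. 1 / 4 * (\<Sum>i=1..N. (Y i \<omega>)\<^sup>2) \<ge> 1 / 4 * (2 * real N)}"
      proof safe
        fix \<omega> assume "2 * real N < (\<Sum>i=1..N. (X i \<omega> \<bullet> Z)\<^sup>2)"
        then show "1 / 4 * (2 * real N) \<le> 1 / 4 * (\<Sum>i=1..N. (Y i \<omega>)\<^sup>2)"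
          using le[of \<omega>] by linarith
      qed
    qed measurable
    also have "\<dots> \<le> exp (- (real N / 2)) * sqrt 2 ^ N"
      using sum_squares_std_normal_tail[OF Yi Yn[OF _ False], of "sqrt 2" "2 * real N"] by simp
    finally show ?thesis .
  qed simp
  show "prob {\<omega> \<in> space M. (\<Sum>i=1..N. (X i \<omega> \<bullet> Z)\<^sup>2) < real N / 4 * (norm Z)\<^sup>2}
      \<le> exp (3 / 8 * real N) * (1 / 2) ^ N"
  proof (cases "Z = 0")
    case False
    have "prob {\<omega> \<in> space M. (\<Sum>i=1..N. (X i \<omega> \<bullet> Z)\<^sup>2) < real N / 4 * (norm Z)\<^sup>2}
        \<le> prob {\<omega> \<in> space M. - 3 / 2 * (\<Sum>i=1..N. (Y i \<omega>)\<^sup>2) \<ge> - 3 / 2 * (real N / 4)}"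
    proof (rule finite_measure_mono)
      show "{\<omega> \<in> space M. (\<Sum>i=1..N. (X i \<omega> \<bullet> Z)\<^sup>2) < real N / 4 * (norm Z)\<^sup>2}
        \<subseteq> {\<omega> \<in> space M. - 3 / 2 * (\<Sum>i=1..N. (Y i \<omega>)\<^sup>2) \<ge> - 3 / 2 * (real N / 4)}"
      proof safe
        fix \<omega> assume "(\<Sum>i=1..N. (X i \<omega> \<bullet> Z)\<^sup>2) < real N / 4 * (norm Z)\<^sup>2"
        then have "(norm Z)\<^sup>2 * (\<Sum>i=1..N. (Y i \<omega>)\<^sup>2) < (norm Z)\<^sup>2 * (real N / 4)"
          unfolding XY by (simp only: mult.commute)
        then have "(\<Sum>i=1..N. (Y i \<omega>)\<^sup>2) < real N / 4"
          using False by (subst (asm) mult_less_cancel_left_pos) auto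
        then show "- 3 / 2 * (real N / 4) \<le> - 3 / 2 * (\<Sum>i=1..N. (Y i \<omega>)\<^sup>2)" by linarith
      qed
    qed measurable
    also have "\<dots> \<le> exp (3 / 8 * real N) * (1 / 2) ^ N"
      using sum_squares_std_normal_tail[OF Yi Yn[OF _ False], of "1 / 2" "real N / 4"]
      by (simp add: power2_eq_square)
    finally show ?thesis .
  qed simp
qed

lemma (in prob_space) prob_UN_le_card_mult:
  assumes "finite I" "\<And>i. i \<in> I \<Longrightarrow> A i \<in> events" "\<And>i. i \<in> I \<Longrightarrow> prob (A i) \<le> p"
  shows "prob (\<Union>i\<in>I. A i) \<le> real (card I) * p"
proof -
  have "prob (\<Union>i\<in>I. A i) \<le> (\<Sum>i\<in>I. prob (A i))"
    using assms(1,2) by (intro finite_measure_subadditive_finite) auto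
  also have "\<dots> \<le> real (card I) * p" by (rule sum_bounded_above) (rule assms(3))
  finally show ?thesis .
qed

theorem corollary6:
  fixes M :: "'a measure"
    and \<Theta>' :: "real^'p^'k"
    and X :: "nat \<Rightarrow> 'a \<Rightarrow> real^'p^'k"
    and y :: "nat \<Rightarrow> 'a \<Rightarrow> real"
    and r N :: nat
  assumes "prob_space M"
    and "rank \<Theta>' = r"
    and "r \<ge> 1"
    and "N > 40^2 * r * (CARD('k) + CARD('p))"
    and "prob_space.indep_vars M (\<lambda>_. borel) X {1..N}"
    and "\<And>i. i \<in> {1..N} \<Longrightarrow>
           prob_space.indep_vars M (\<lambda>_. borel) (\<lambda>(a, b) \<omega>. X i \<omega> $ a $ b) (UNIV :: ('k \<times> 'p) set)"
    and "\<And>i a b. i \<in> {1..N} \<Longrightarrow> distributed M lborel (\<lambda>\<omega>. X i \<omega> $ a $ b) std_normal_density"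
    and "\<And>i \<omega>. i \<in> {1..N} \<Longrightarrow> \<omega> \<in> space M \<Longrightarrow> y i \<omega> = trace (transpose (X i \<omega>) ** \<Theta>')"
  shows "measure M {\<omega> \<in> space M.
           {\<Theta>. is_arg_min nuclear_norm
                  (\<lambda>\<Theta>. \<forall>i\<in>{1..N}. trace (transpose (X i \<omega>) ** \<Theta>) = y i \<omega>) \<Theta>} = {\<Theta>'}}
         \<ge> 1 - 2 * exp (- real N / 32)"
proof -
  interpret prob_space M by fact
  define n where "n = CARD('k) + CARD('p)"
  \<comment> \<open>The sparsification needs \<open>(m - 1) / (16 * r) > 8\<close>, that is, slightly more than \<open>128 * r\<close> atoms.\<close>
  define m where "m = 130 * r"
  have N: "real N > 1600 * real r * real n"
  proof -
    have "real (1600 * r * n) < real N" using assms(4) unfolding of_nat_less_iff by (simp add: n_def)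
    then show ?thesis by simp
  qed
  have N1: "real N > 1600 * real n"
  proof -
    have "1 * real n \<le> real r * real n" using \<open>r \<ge> 1\<close> by (intro mult_right_mono) auto
    then show ?thesis using N by simp
  qed
  then have N0: "real N > 0" by (simp add: le_less_trans)
  have Xm: "X i \<in> borel_measurable M" if "i \<in> {1..N}" for i
    using assms(5) that unfolding indep_vars_def by auto
  note tail = gaussian_measurements_tail[OF assms(5,6,7)]
  obtain S :: "(real^'p^'k) set" where S: "finite S" "S \<subseteq> cball 0 1" "card S \<le> 9 ^ n"
    "\<forall>u v. norm u \<le> 1 \<longrightarrow> norm v \<le> 1 \<longrightarrow> (9 / 16) *\<^sub>R outer u v \<in> convex hull S"
    unfolding n_def by (rule finite_atoms)
  define Z where "Z = sum_list ` {l. set l \<subseteq> S \<and> length l = m}"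
  have Zfin: "finite Z" unfolding Z_def using S(1) by (intro finite_imageI finite_lists_length_eq)
  have cS: "real (card S) \<le> 9 ^ n" using S(3) by (metis of_nat_le_iff of_nat_numeral of_nat_power)
  have "card Z \<le> card S ^ m"
    unfolding Z_def card_lists_length_eq[OF S(1), symmetric]
    using S(1) by (intro card_image_le finite_lists_length_eq)
  then have "real (card Z) \<le> real (card S) ^ m" by (metis of_nat_le_iff of_nat_power)
  also have "\<dots> \<le> (9 ^ n) ^ m" using cS by (intro power_mono) auto
  finally have cZ: "real (card Z) \<le> (9 ^ n) ^ m" .
  \<comment> \<open>Outside the events \<open>E1\<close> no atom has too large measurements, outside the events \<open>E2\<close> no sum of
    \<open>m\<close> atoms has too small ones.\<close>
  define E1 where "E1 s = {\<omega> \<in> space M. 2 * real N < (\<Sum>i=1..N. (X i \<omega> \<bullet> s)\<^sup>2)}" for s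
  define E2 where "E2 z = {\<omega> \<in> space M. (\<Sum>i=1..N. (X i \<omega> \<bullet> z)\<^sup>2) < real N / 4 * (norm z)\<^sup>2}" for z
  have [measurable]: "(\<lambda>\<omega>. \<Sum>i=1..N. (X i \<omega> \<bullet> s)\<^sup>2) \<in> borel_measurable M" for s
    using Xm by (intro borel_measurable_sum borel_measurable_power borel_measurable_inner) auto
  have E1m: "E1 s \<in> events" and E2m: "E2 s \<in> events" for s
    unfolding E1_def E2_def by measurable
  have "prob (\<Union>s\<in>S. E1 s) \<le> real (card S) * (exp (- (real N / 2)) * sqrt 2 ^ N)"
  proof (intro prob_UN_le_card_mult S(1) E1m)
    show "prob (E1 s) \<le> exp (- (real N / 2)) * sqrt 2 ^ N" if "s \<in> S" for s
      unfolding E1_def by (rule tail(1)) (use S(2) that in auto)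
  qed
  also have "\<dots> \<le> 9 ^ n * (exp (- (real N / 2)) * sqrt 2 ^ N)"
    using cS by (intro mult_right_mono) auto
  also have "\<dots> \<le> exp (- real N / 32)" by (rule upper_union_bound_small[OF N1])
  finally have P1: "prob (\<Union>s\<in>S. E1 s) \<le> exp (- real N / 32)" .
  have "prob (\<Union>z\<in>Z. E2 z) \<le> real (card Z) * (exp (3 / 8 * real N) * (1 / 2) ^ N)"
    by (intro prob_UN_le_card_mult Zfin E2m) (unfold E2_def, rule tail(2))
  also have "\<dots> \<le> (9 ^ n) ^ m * (exp (3 / 8 * real N) * (1 / 2) ^ N)"
    using cZ by (intro mult_right_mono) auto
  also have "\<dots> \<le> exp (- real N / 32)" unfolding m_def by (rule lower_union_bound_small[OF N])
  finally have P2: "prob (\<Union>z\<in>Z. E2 z) \<le> exp (- real N / 32)" .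
  define Bad where "Bad = {\<omega> \<in> space M. \<exists>\<Delta>. \<Delta> \<noteq> 0 \<and>
    nuclear_norm (\<Theta>' + \<Delta>) \<le> nuclear_norm \<Theta>' \<and> (\<forall>i\<in>{1..N}. X i \<omega> \<bullet> \<Delta> = 0)}"
  have Badm: "Bad \<in> events"
    unfolding Bad_def by (rule recovery_failure_measurable) (use Xm in auto)
  \<comment> \<open>This inclusion is deterministic: if no atom has too large measurements, a descent direction in the kernel
    yields a sum of atoms with too small ones.\<close>
  have "Bad \<subseteq> (\<Union>s\<in>S. E1 s) \<union> (\<Union>z\<in>Z. E2 z)"
  proof
    fix \<omega> assume "\<omega> \<in> Bad"
    then obtain \<Delta> where \<omega>: "\<omega> \<in> space M" and \<Delta>: "\<Delta> \<noteq> 0"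
      "nuclear_norm (\<Theta>' + \<Delta>) \<le> nuclear_norm \<Theta>'" "\<And>i. i \<in> {1..N} \<Longrightarrow> X i \<omega> \<bullet> \<Delta> = 0"
      unfolding Bad_def by blast
    show "\<omega> \<in> (\<Union>s\<in>S. E1 s) \<union> (\<Union>z\<in>Z. E2 z)"
    proof (rule ccontr)
      assume out: "\<not> ?thesis"
      have "rank \<Theta>' \<ge> 1" using assms(2,3) by simp
      then obtain t where t: "t *\<^sub>R \<Delta> \<in> convex hull S"
        "1 \<le> real (16 * rank \<Theta>') * (norm (t *\<^sub>R \<Delta>))\<^sup>2"
        by (rule descent_direction_in_hull[OF \<Delta>(2,1) _ S(4)])
      have "\<exists>l. set l \<subseteq> S \<and> length l = m \<and>
        (\<Sum>i\<in>{1..N}. (X i \<omega> \<bullet> sum_list l)\<^sup>2) < real N / 4 * (norm (sum_list l))\<^sup>2"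
      proof (rule kernel_in_hull_gives_short_sum[OF S(1) t(1) _ N0])
        show "X i \<omega> \<bullet> t *\<^sub>R \<Delta> = 0" if "i \<in> {1..N}" for i using \<Delta>(3)[OF that] by simp
        show "(\<Sum>i\<in>{1..N}. (X i \<omega> \<bullet> s)\<^sup>2) \<le> 2 * real N" if "s \<in> S" for s
          using out \<omega> that by (auto simp: E1_def not_less)
        have "129 * real r \<le> real m - 1" using assms(3) by (simp add: m_def)
        then have "129 * real r * (norm (t *\<^sub>R \<Delta>))\<^sup>2 \<le> (real m - 1) * (norm (t *\<^sub>R \<Delta>))\<^sup>2"
          by (rule mult_right_mono) simp
        moreover have "8 < 129 * real r * (norm (t *\<^sub>R \<Delta>))\<^sup>2"
          using t(2) unfolding assms(2) of_nat_mult of_nat_numeral by linarith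
        ultimately show "8 < (real m - 1) * (norm (t *\<^sub>R \<Delta>))\<^sup>2" by linarith
      qed
      then show False using out \<omega> by (auto simp: E2_def Z_def)
    qed
  qed
  then have "prob Bad \<le> prob ((\<Union>s\<in>S. E1 s) \<union> (\<Union>z\<in>Z. E2 z))"
    using S(1) Zfin E1m E2m by (intro finite_measure_mono sets.Un sets.finite_UN) auto
  also have "\<dots> \<le> prob (\<Union>s\<in>S. E1 s) + prob (\<Union>z\<in>Z. E2 z)"
    using S(1) Zfin E1m E2m by (intro measure_Un_le sets.finite_UN) auto
  finally have PBad: "prob Bad \<le> 2 * exp (- real N / 32)" using P1 P2 by simp
  have "{\<omega> \<in> space M. {\<Theta>. is_arg_min nuclear_norm
      (\<lambda>\<Theta>. \<forall>i\<in>{1..N}. trace (transpose (X i \<omega>) ** \<Theta>) = y i \<omega>) \<Theta>} = {\<Theta>'}} = space M - Bad"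
  proof -
    have "{\<Theta>. is_arg_min nuclear_norm (\<lambda>\<Theta>. \<forall>i\<in>{1..N}. trace (transpose (X i \<omega>) ** \<Theta>) = y i \<omega>) \<Theta>} = {\<Theta>'}
        \<longleftrightarrow> \<omega> \<notin> Bad" if \<omega>: "\<omega> \<in> space M" for \<omega>
    proof -
      have yi: "y i \<omega> = X i \<omega> \<bullet> \<Theta>'" if "i \<in> {1..N}" for i
        using assms(8)[OF that \<omega>] by (simp add: trace_transpose_mult)
      have "(\<exists>\<Theta>. (\<forall>i\<in>{1..N}. X i \<omega> \<bullet> \<Theta> = y i \<omega>) \<and> \<Theta> \<noteq> \<Theta>' \<and> nuclear_norm \<Theta> \<le> nuclear_norm \<Theta>')
          \<longleftrightarrow> \<omega> \<in> Bad" (is "?L \<longleftrightarrow> _")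
      proof
        assume ?L
        then obtain \<Theta> where \<Theta>: "\<forall>i\<in>{1..N}. X i \<omega> \<bullet> \<Theta> = y i \<omega>" "\<Theta> \<noteq> \<Theta>'"
          "nuclear_norm \<Theta> \<le> nuclear_norm \<Theta>'" by blast
        then show "\<omega> \<in> Bad"
          unfolding Bad_def using \<omega> yi by (auto intro!: exI[of _ "\<Theta> - \<Theta>'"] simp: inner_diff_right)
      next
        assume "\<omega> \<in> Bad"
        then obtain \<Delta> where "\<Delta> \<noteq> 0" "nuclear_norm (\<Theta>' + \<Delta>) \<le> nuclear_norm \<Theta>'"
          "\<forall>i\<in>{1..N}. X i \<omega> \<bullet> \<Delta> = 0" unfolding Bad_def by blast
        then show ?L using yi by (intro exI[of _ "\<Theta>' + \<Delta>"]) (auto simp: inner_add_right)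
      qed
      then show ?thesis
        unfolding is_arg_min_singleton_iff trace_transpose_mult using yi by auto
    qed
    then show ?thesis by blast
  qed
  then show ?thesis using prob_compl[OF Badm] PBad by simp
qed

end
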